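(* Every parabolic rotational surface of constant mean curvature $H$ (with $H\ge0$) satisfying $H^2<1$ in $\mathbb{H}^3\subset\mathbb{R}^{3,1}$ is given, with respect to a suitable pseudo-orthonormal basis $(\mathfrak v,\mathfrak e_1,\mathfrak o,\mathfrak e_2)$ of $\mathbb{R}^{3,1}$, by $$(\theta,t)\mapsto\left(\frac{1+r^2(t)(\psi^2(t)+\theta^2)}{2r(t)},\ r(t)\theta,\ r(t),\ r(t)\psi(t)\right)$$ with the functions $$r(t)=\frac{\sqrt{C^+}}{\operatorname{cn}_p(\Xi t)},\qquad p^2=\begin{cases}\frac{1+H}{2}&\text{for }C>0\\[2pt]\frac{1-H}{2}&\text{for }C<0,\end{cases}$$ $$\psi(t)=t-\frac{2}{\Xi}\,\big(E_p\circ\operatorname{am}_p\big)(\Xi t),$$ where $C\in\mathbb{R}\setminus\{0\}$ is a constant, $\Xi=\sqrt{|2C|}$, and $C^+$ is the positive one of the two numbers $\frac{C}{H+1},\frac{C}{H-1}$.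
   Context: $\mathbb{R}^{3,1}$ is Minkowski space (signature $(+++-)$) and $\mathbb{H}^3$ is hyperbolic space of curvature $-1$, realized as (one sheet of) $\{x\in\mathbb{R}^{3,1}:(x,x)=-1\}$. A pseudo-orthonormal basis $(\mathfrak v,\mathfrak e_1,\mathfrak o,\mathfrak e_2)$ satisfies: $\mathfrak v,\mathfrak o$ lightlike with $(\mathfrak v,\mathfrak o)=-1$, $\mathfrak e_1,\mathfrak e_2$ unit spacelike, and all other inner products vanish. Coordinates in the parametrization are with respect to this ordered basis. Mean curvature is the mean of the principal curvatures; the orientation of the unit normal is always chosen such that $H\ge0$. A surface in $\mathbb{H}^3$ is parabolic rotational if it is invariant under a 1-parameter group of isometries acting as the identity on the orthogonal complement of a 2-plane $\Pi_1$ of signature $(+0)$; for $\Pi_1=\langle\mathfrak v,\mathfrak e_1\rangle$ this group is $\mathfrak v\mapsto\mathfrak v$, $\mathfrak e_1\mapsto\mathfrak e_1+\theta\mathfrak v$, $\mathfrak o\mapsto\mathfrak o+\theta\mathfrak e_1+\frac{\theta^2}{2}\mathfrak v$, $\mathfrak e_2\mapsto\mathfrak e_2$. $\operatorname{cn}_p$ is the Jacobi elliptic cosine with modulus $p$, $\operatorname{am}_p$ the Jacobi amplitude, and $E_p(\varphi)=\int_0^{\varphi}\sqrt{1-p^2\sin^2u}\,du$ the incomplete elliptic integral of the second kind, so that $(E_p\circ\operatorname{am}_p)(s)=\int_0^s\operatorname{dn}_p^2(u)\,du$.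
   Formalization: The formal theorem assumes the surface is not totally umbilic: totally umbilic ones (e.g. totally geodesic planes, H=0) are parabolic rotational with constant H, H²<1, but correspond to C=0 and are never of the stated form with C≠0. *)

theory Defs
  imports "HOL-Analysis.Analysis"
begin

definition mink :: "real^4 \<Rightarrow> real^4 \<Rightarrow> real" where
  "mink x y = x $ 1 * y $ 1 + x $ 2 * y $ 2 + x $ 3 * y $ 3 - x $ 4 * y $ 4"

definition hyperbolic_space :: "(real^4) set" where
  "hyperbolic_space = {x. mink x x = -1 \<and> x $ 4 > 0}"

text \<open>The Gram matrix below is nondegenerate, so the four vectors do form a basis.\<close>

definition pseudo_orthonormal_basis :: "real^4 \<Rightarrow> real^4 \<Rightarrow> real^4 \<Rightarrow> real^4 \<Rightarrow> bool" where
  "pseudo_orthonormal_basis \<vv> \<ee>\<^sub>1 \<oo> \<ee>\<^sub>2 \<longleftrightarrow>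
     mink \<vv> \<vv> = 0 \<and> mink \<oo> \<oo> = 0 \<and> mink \<vv> \<oo> = -1 \<and>
     mink \<ee>\<^sub>1 \<ee>\<^sub>1 = 1 \<and> mink \<ee>\<^sub>2 \<ee>\<^sub>2 = 1 \<and> mink \<ee>\<^sub>1 \<ee>\<^sub>2 = 0 \<and>
     mink \<vv> \<ee>\<^sub>1 = 0 \<and> mink \<vv> \<ee>\<^sub>2 = 0 \<and> mink \<oo> \<ee>\<^sub>1 = 0 \<and> mink \<oo> \<ee>\<^sub>2 = 0"


text \<open>
  Surfaces are connected and immersed (self-intersections are allowed: the profile curves
  can have loops). It is enough to let the parameter domain be a connected open
  subset of the plane: a connected abstract surface can be replaced by its universal cover
  without changing the image, and a sphere cannot have an image with the noncompact symmetry
  group considered below.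
\<close>

primrec Ck_on :: "nat \<Rightarrow> 'a::real_normed_vector set \<Rightarrow> ('a \<Rightarrow> 'b::real_normed_vector) \<Rightarrow> bool" where
  "Ck_on 0 U f \<longleftrightarrow> continuous_on U f"
| "Ck_on (Suc k) U f \<longleftrightarrow> (\<forall>x\<in>U. f differentiable (at x)) \<and>
     (\<forall>w. Ck_on k U (\<lambda>x. frechet_derivative f (at x) w))"

definition smooth_on :: "'a::real_normed_vector set \<Rightarrow> ('a \<Rightarrow> 'b::real_normed_vector) \<Rightarrow> bool" where
  "smooth_on U f \<longleftrightarrow> (\<forall>k. Ck_on k U f)"

definition immersed_surface :: "(real \<times> real) set \<Rightarrow> (real \<times> real \<Rightarrow> real^4) \<Rightarrow> bool" where
  "immersed_surface U X \<longleftrightarrow> open U \<and> connected U \<and> U \<noteq> {} \<and> smooth_on U X \<and>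
     X ` U \<subseteq> hyperbolic_space \<and> (\<forall>u\<in>U. inj (frechet_derivative X (at u)))"

definition unit_normal_field ::
  "(real \<times> real) set \<Rightarrow> (real \<times> real \<Rightarrow> real^4) \<Rightarrow> (real \<times> real \<Rightarrow> real^4) \<Rightarrow> bool" where
  "unit_normal_field U X N \<longleftrightarrow> smooth_on U N \<and>
     (\<forall>u\<in>U. mink (N u) (N u) = 1 \<and> mink (N u) (X u) = 0 \<and>
        (\<forall>w. mink (N u) (frechet_derivative X (at u) w) = 0))"

text \<open>
  Since the normal is orthogonal to the position vector, its covariant derivative in hyperbolic
  space is its ordinary derivative, so the shape operator \<open>A\<close> is given by \<open>dN = - dX \<circ> A\<close>.
  The vectors \<open>w\<^sub>1, w\<^sub>2\<close> are orthonormal eigenvectors of \<open>A\<close>; thus \<open>\<kappa>\<^sub>1, \<kappa>\<^sub>2\<close> are its eigenvalues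
  with multiplicity, determined up to order.
\<close>

definition principal_curvatures ::
  "(real \<times> real \<Rightarrow> real^4) \<Rightarrow> (real \<times> real \<Rightarrow> real^4) \<Rightarrow> real \<times> real \<Rightarrow> real \<Rightarrow> real \<Rightarrow> bool" where
  "principal_curvatures X N u \<kappa>\<^sub>1 \<kappa>\<^sub>2 \<longleftrightarrow>
     (let dX = frechet_derivative X (at u); dN = frechet_derivative N (at u) in
      \<exists>w\<^sub>1 w\<^sub>2. mink (dX w\<^sub>1) (dX w\<^sub>1) = 1 \<and> mink (dX w\<^sub>2) (dX w\<^sub>2) = 1 \<and> mink (dX w\<^sub>1) (dX w\<^sub>2) = 0 \<and>
        dN w\<^sub>1 = - \<kappa>\<^sub>1 *\<^sub>R dX w\<^sub>1 \<and> dN w\<^sub>2 = - \<kappa>\<^sub>2 *\<^sub>R dX w\<^sub>2)"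

definition has_mean_curvature ::
  "(real \<times> real \<Rightarrow> real^4) \<Rightarrow> (real \<times> real \<Rightarrow> real^4) \<Rightarrow> real \<times> real \<Rightarrow> real \<Rightarrow> bool" where
  "has_mean_curvature X N u H \<longleftrightarrow> (\<exists>\<kappa>\<^sub>1 \<kappa>\<^sub>2. principal_curvatures X N u \<kappa>\<^sub>1 \<kappa>\<^sub>2 \<and> H = (\<kappa>\<^sub>1 + \<kappa>\<^sub>2) / 2)"

text \<open>
  Totally umbilic surfaces have to be excluded from the classification: for every \<open>0 \<le> H < 1\<close> there
  are totally umbilic parabolic rotational surfaces of constant mean curvature \<open>H\<close> (vertical or tilted planes
  in the half-space model), which correspond to the value \<open>C = 0\<close> of the integration constant.
\<close>

definition totally_umbilic ::
  "(real \<times> real) set \<Rightarrow> (real \<times> real \<Rightarrow> real^4) \<Rightarrow> (real \<times> real \<Rightarrow> real^4) \<Rightarrow> bool" where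
  "totally_umbilic U X N \<longleftrightarrow> (\<forall>u\<in>U. \<forall>\<kappa>\<^sub>1 \<kappa>\<^sub>2. principal_curvatures X N u \<kappa>\<^sub>1 \<kappa>\<^sub>2 \<longrightarrow> \<kappa>\<^sub>1 = \<kappa>\<^sub>2)"


definition lorentz_isometry :: "(real^4 \<Rightarrow> real^4) \<Rightarrow> bool" where
  "lorentz_isometry g \<longleftrightarrow> linear g \<and> (\<forall>x y. mink (g x) (g y) = mink x y)"

text \<open>A one-parameter group is understood to be continuous and nontrivial.\<close>

definition one_parameter_group :: "(real \<Rightarrow> real^4 \<Rightarrow> real^4) \<Rightarrow> bool" where
  "one_parameter_group \<rho> \<longleftrightarrow> (\<forall>s. lorentz_isometry (\<rho> s)) \<and>
     (\<forall>s t. \<rho> (s + t) = \<rho> s \<circ> \<rho> t) \<and>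
     (\<forall>x. continuous_on UNIV (\<lambda>s. \<rho> s x)) \<and> (\<exists>s. \<rho> s \<noteq> id)"

definition signature_plus_zero :: "(real^4) set \<Rightarrow> bool" where
  "signature_plus_zero P \<longleftrightarrow>
     (\<exists>a b. b \<noteq> 0 \<and> mink a a = 1 \<and> mink b b = 0 \<and> mink a b = 0 \<and> P = span {a, b})"

definition parabolic_rotational :: "(real^4) set \<Rightarrow> bool" where
  "parabolic_rotational S \<longleftrightarrow>
     (\<exists>P \<rho>. signature_plus_zero P \<and> one_parameter_group \<rho> \<and>
        (\<forall>s x. (\<forall>y\<in>P. mink x y = 0) \<longrightarrow> \<rho> s x = x) \<and>
        (\<forall>s. \<rho> s ` S = S))"


text \<open>
  The argument \<open>p\<close> is always the modulus (not the parameter \<open>p\<^sup>2\<close>), with \<open>0 \<le> p < 1\<close>. Interval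
  integrals are oriented, so negative arguments are covered. For such \<open>p\<close> the function
  \<open>elliptic_F p\<close> is a strictly increasing bijection of the reals, with inverse \<open>jacobi_am p\<close>.
\<close>

definition elliptic_F :: "real \<Rightarrow> real \<Rightarrow> real" where
  "elliptic_F p \<phi> = (LBINT u=0..\<phi>. 1 / sqrt (1 - p\<^sup>2 * (sin u)\<^sup>2))"

definition elliptic_E :: "real \<Rightarrow> real \<Rightarrow> real" where
  "elliptic_E p \<phi> = (LBINT u=0..\<phi>. sqrt (1 - p\<^sup>2 * (sin u)\<^sup>2))"

definition jacobi_am :: "real \<Rightarrow> real \<Rightarrow> real" where
  "jacobi_am p s = (THE \<phi>. elliptic_F p \<phi> = s)"

definition jacobi_cn :: "real \<Rightarrow> real \<Rightarrow> real" where
  "jacobi_cn p s = cos (jacobi_am p s)"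


definition C_plus :: "real \<Rightarrow> real \<Rightarrow> real" where
  "C_plus H C = (if C / (H + 1) > 0 then C / (H + 1) else C / (H - 1))"

definition cmc_modulus :: "real \<Rightarrow> real \<Rightarrow> real" where
  "cmc_modulus H C = sqrt (if C > 0 then (1 + H) / 2 else (1 - H) / 2)"

definition cmc_Xi :: "real \<Rightarrow> real" where
  "cmc_Xi C = sqrt \<bar>2 * C\<bar>"

definition cmc_r :: "real \<Rightarrow> real \<Rightarrow> real \<Rightarrow> real" where
  "cmc_r H C t = sqrt (C_plus H C) / jacobi_cn (cmc_modulus H C) (cmc_Xi C * t)"

definition cmc_psi :: "real \<Rightarrow> real \<Rightarrow> real \<Rightarrow> real" where
  "cmc_psi H C t = t - 2 / cmc_Xi C *
     (elliptic_E (cmc_modulus H C) \<circ> jacobi_am (cmc_modulus H C)) (cmc_Xi C * t)"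

end

theory Submission
  imports Defs
begin

text \<open>
  In upper half-space coordinates \<open>(\<theta>, \<psi>, z)\<close> with \<open>z = 1 / r\<close> the rotations are the translations in \<open>\<theta>\<close>,
  so the surface is a cylinder over a profile curve in the \<open>(\<psi>, z)\<close> half-plane. Let \<open>(B, A)\<close> be the
  unit normal of that curve. One principal curvature is \<open>A\<close> (along the orbits), the other is \<open>2H - A\<close>,
  which amounts to \<open>dA = 2 (A - H) dz / z\<close>. Hence \<open>A = H - C z\<^sup>2\<close> with a constant \<open>C\<close>, which is nonzero
  unless the surface is totally umbilic. With \<open>t\<close> the Euclidean arc length this gives
  \<open>\<psi>' = H - C z\<^sup>2\<close> and \<open>z'\<^sup>2 = 1 - (H - C z\<^sup>2)\<^sup>2\<close> for \<open>C > 0\<close>, whose solutions are elliptic;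
  reversing the normal changes the signs of \<open>H\<close> and \<open>C\<close> and reduces \<open>C < 0\<close> to this case.
  The substitution \<open>sin \<phi> = B / sqrt ((1 + H) (1 - A))\<close>, \<open>t = F\<^sub>p(\<phi>) / \<Xi>\<close> describes the whole curve
  at once, without exceptional points where \<open>z' = 0\<close>.
\<close>

section \<open>Minkowski space and parabolic rotations\<close>

lemma bounded_bilinear_mink: "bounded_bilinear mink"
proof -
  have lin: "bounded_linear (\<lambda>y::real^4. \<chi> i. if i = 4 then - y $ i else y $ i)"
    by (rule linear_linear[THEN iffD2], rule linearI) (auto simp: vec_eq_iff)
  have mink: "mink = (\<lambda>x y. x \<bullet> (\<chi> i. if i = 4 then - y $ i else y $ i))"
    by (auto simp: fun_eq_iff mink_def inner_vec_def sum_4)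
  show ?thesis
    unfolding mink
    by (rule bounded_bilinear.comp[OF bounded_bilinear_inner bounded_linear_ident lin])
qed

interpretation mink: bounded_bilinear mink
  by (rule bounded_bilinear_mink)

lemmas mink_algebra = mink.add_left mink.add_right mink.diff_left mink.diff_right
  mink.scaleR_left mink.scaleR_right mink.minus_left mink.minus_right
  mink.zero_left mink.zero_right

lemma mink_commute: "mink x y = mink y x"
  by (simp add: mink_def mult.commute)

section \<open>Causal vectors and time orientation\<close>

lemma causal_eq_zero:
  assumes "mink x x \<le> 0" "x $ 4 = 0"
  shows "x = 0"
proof -
  have "(x$1)\<^sup>2 + (x$2)\<^sup>2 + (x$3)\<^sup>2 \<le> 0"
    using assms by (simp add: mink_def power2_eq_square)
  then have "(x$1)\<^sup>2 = 0 \<and> (x$2)\<^sup>2 = 0 \<and> (x$3)\<^sup>2 = 0"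
    using zero_le_power2[of "x$1"] zero_le_power2[of "x$2"] zero_le_power2[of "x$3"] by linarith
  with assms show ?thesis by (simp add: vec_eq_iff forall_4)
qed

text \<open>Orthogonality would make the spatial inner product equal to the product of the time
  coordinates, but Euclidean Cauchy-Schwarz bounds its square strictly below that. Thus the
  orthogonal complement of a timelike vector is positive definite.\<close>

lemma mink_strict_reversed_Cauchy_Schwarz:
  assumes "mink t t < 0" "mink x x \<le> 0" "x \<noteq> 0"
  shows "mink t x \<noteq> 0"
proof
  assume *: "mink t x = 0"
  let ?a = "t$1" and ?b = "t$2" and ?c = "t$3" and ?d = "t$4"
  let ?x = "x$1" and ?y = "x$2" and ?z = "x$3" and ?w = "x$4"
  have t: "?a\<^sup>2 + ?b\<^sup>2 + ?c\<^sup>2 < ?d\<^sup>2" and x: "?x\<^sup>2 + ?y\<^sup>2 + ?z\<^sup>2 \<le> ?w\<^sup>2"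
    and tx: "?a * ?x + ?b * ?y + ?c * ?z = ?d * ?w"
    using assms * by (auto simp: mink_def power2_eq_square)
  have "?w \<noteq> 0"
    using causal_eq_zero assms by blast
  have "(?a * ?x + ?b * ?y + ?c * ?z)\<^sup>2 \<le> (?a\<^sup>2 + ?b\<^sup>2 + ?c\<^sup>2) * (?x\<^sup>2 + ?y\<^sup>2 + ?z\<^sup>2)"
  proof -
    \<comment> \<open>Lagrange's identity.\<close>
    have "(?a\<^sup>2 + ?b\<^sup>2 + ?c\<^sup>2) * (?x\<^sup>2 + ?y\<^sup>2 + ?z\<^sup>2) - (?a * ?x + ?b * ?y + ?c * ?z)\<^sup>2
      = (?a * ?y - ?b * ?x)\<^sup>2 + (?a * ?z - ?c * ?x)\<^sup>2 + (?b * ?z - ?c * ?y)\<^sup>2"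
      by algebra
    then show ?thesis by (smt (verit) zero_le_power2)
  qed
  also have "\<dots> \<le> (?a\<^sup>2 + ?b\<^sup>2 + ?c\<^sup>2) * ?w\<^sup>2"
    using x by (intro mult_left_mono) auto
  also have "\<dots> < ?d\<^sup>2 * ?w\<^sup>2"
    using t \<open>?w \<noteq> 0\<close> by (intro mult_strict_right_mono) auto
  finally show False using tx by (simp add: power_mult_distrib)
qed

text \<open>The segment from \<open>t\<close> to the time axis stays timelike, so the product with
  \<open>x\<close> cannot vanish along it; at the far end it is \<open>- x $ 4\<close>.\<close>

lemma mink_future_neg:
  assumes "mink t t < 0" "t $ 4 > 0" "mink x x = 0" "x $ 4 > 0"
  shows "mink t x < 0"
proof -
  let ?f = "\<lambda>s. mink ((1 - s) *\<^sub>R t + s *\<^sub>R axis 4 1) x"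
  have neg: "mink ((1 - s) *\<^sub>R t + s *\<^sub>R axis 4 1) ((1 - s) *\<^sub>R t + s *\<^sub>R axis 4 1) < 0"
    if "s \<in> {0..1}" for s
  proof -
    have "(1-s)\<^sup>2 * mink t t + 2 * s * (1-s) * (- (t$4)) - s\<^sup>2 < 0"
    proof (cases "s = 1")
      case False
      with that have "(1-s)\<^sup>2 * mink t t < 0" using assms(1) by (simp add: mult_pos_neg)
      moreover have "2 * s * (1-s) * t$4 \<ge> 0" using that assms by auto
      ultimately show ?thesis by (smt (verit) zero_le_power2 mult_minus_right)
    qed simp
    then show ?thesis
      by (simp add: mink_def axis_def power2_eq_square algebra_simps)
  qed
  show ?thesis
  proof (rule ccontr)
    assume "\<not> mink t x < 0"
    then have "?f 1 \<le> 0" "0 \<le> ?f 0" 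
      using assms by (auto simp: mink_def axis_def)
    moreover have "continuous_on {0..1} ?f"
      by (intro continuous_intros mink.continuous_on)
    ultimately obtain s where "s \<in> {0..1}" "?f s = 0"
      using IVT2'[of ?f 1 0 0] by auto
    moreover have "x \<noteq> 0" using assms(4) by auto
    ultimately show False
      using mink_strict_reversed_Cauchy_Schwarz[OF neg, of s x] assms(3) by auto
  qed
qed

section \<open>Pseudo-orthonormal bases and the parabolic group\<close>

locale pseudo_orthonormal =
  fixes \<vv> \<ee>\<^sub>1 \<oo> \<ee>\<^sub>2 :: "real^4"
  assumes basis: "pseudo_orthonormal_basis \<vv> \<ee>\<^sub>1 \<oo> \<ee>\<^sub>2"
begin

lemma gram [simp]:
  "mink \<vv> \<vv> = 0" "mink \<oo> \<oo> = 0" "mink \<vv> \<oo> = -1" "mink \<oo> \<vv> = -1"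
  "mink \<ee>\<^sub>1 \<ee>\<^sub>1 = 1" "mink \<ee>\<^sub>2 \<ee>\<^sub>2 = 1" "mink \<ee>\<^sub>1 \<ee>\<^sub>2 = 0" "mink \<ee>\<^sub>2 \<ee>\<^sub>1 = 0"
  "mink \<vv> \<ee>\<^sub>1 = 0" "mink \<ee>\<^sub>1 \<vv> = 0" "mink \<vv> \<ee>\<^sub>2 = 0" "mink \<ee>\<^sub>2 \<vv> = 0"
  "mink \<oo> \<ee>\<^sub>1 = 0" "mink \<ee>\<^sub>1 \<oo> = 0" "mink \<oo> \<ee>\<^sub>2 = 0" "mink \<ee>\<^sub>2 \<oo> = 0"
  using basis mink_commute unfolding pseudo_orthonormal_basis_def by metis+

text \<open>The Gram relations make the four vectors independent, hence spanning. The two lightlike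
  vectors are dual to each other up to sign, so each coefficient of one is read off by pairing with
  the other.\<close>

lemma expansion:
  "x = (- mink x \<oo>) *\<^sub>R \<vv> + mink x \<ee>\<^sub>1 *\<^sub>R \<ee>\<^sub>1 + (- mink x \<vv>) *\<^sub>R \<oo> + mink x \<ee>\<^sub>2 *\<^sub>R \<ee>\<^sub>2"
proof -
  let ?f = "\<lambda>c::real^4. (c$1) *\<^sub>R \<vv> + (c$2) *\<^sub>R \<ee>\<^sub>1 + (c$3) *\<^sub>R \<oo> + (c$4) *\<^sub>R \<ee>\<^sub>2"
  have lin: "linear ?f"
    by (rule linearI) (auto simp: algebra_simps)
  have "inj ?f"
  proof (subst linear_injective_0[OF lin], intro allI impI)
    fix c assume "?f c = 0"
    then have "mink (?f c) \<vv> = 0" "mink (?f c) \<ee>\<^sub>1 = 0" "mink (?f c) \<oo> = 0" "mink (?f c) \<ee>\<^sub>2 = 0"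
      by (simp_all add: mink_algebra)
    then show "c = 0"
      by (simp add: mink_algebra vec_eq_iff forall_4)
  qed
  then have "surj ?f"
    using lin linear_injective_imp_surjective by blast
  then obtain c where "x = ?f c" by blast
  then show ?thesis by (simp add: mink_algebra)
qed

lemma mink_expansion:
  "mink x y = mink x \<ee>\<^sub>1 * mink y \<ee>\<^sub>1 + mink x \<ee>\<^sub>2 * mink y \<ee>\<^sub>2
     - mink x \<vv> * mink y \<oo> - mink x \<oo> * mink y \<vv>"
  by (subst expansion[of x])
    (simp add: mink_algebra mink_commute[of \<vv> y] mink_commute[of \<oo> y]
      mink_commute[of \<ee>\<^sub>1 y] mink_commute[of \<ee>\<^sub>2 y])

lemma eq_if_mink_eq:
  assumes "mink x \<vv> = mink y \<vv>" "mink x \<ee>\<^sub>1 = mink y \<ee>\<^sub>1" "mink x \<oo> = mink y \<oo>" "mink x \<ee>\<^sub>2 = mink y \<ee>\<^sub>2"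
  shows "x = y"
  by (subst expansion[of x], subst expansion[of y]) (simp only: assms)

text \<open>The group of the plane spanned by \<open>\<vv>\<close> and \<open>\<ee>\<^sub>1\<close>,
  extended linearly from its values on the basis: the coefficient of \<open>\<oo>\<close> in
  \<open>x\<close> is \<open>- mink x \<vv>\<close>.\<close>

definition parabolic :: "real \<Rightarrow> real^4 \<Rightarrow> real^4" where
  "parabolic \<theta> x = x + (mink x \<ee>\<^sub>1 * \<theta> - mink x \<vv> * \<theta>\<^sup>2 / 2) *\<^sub>R \<vv> - (mink x \<vv> * \<theta>) *\<^sub>R \<ee>\<^sub>1"

lemma mink_parabolic:
  "mink (parabolic \<theta> x) \<vv> = mink x \<vv>"
  "mink (parabolic \<theta> x) \<ee>\<^sub>1 = mink x \<ee>\<^sub>1 - mink x \<vv> * \<theta>"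
  "mink (parabolic \<theta> x) \<ee>\<^sub>2 = mink x \<ee>\<^sub>2"
  "mink (parabolic \<theta> x) \<oo> = mink x \<oo> - mink x \<ee>\<^sub>1 * \<theta> + mink x \<vv> * \<theta>\<^sup>2 / 2"
  by (simp_all add: parabolic_def mink_algebra)

text \<open>Squaring \<open>h\<close> removes the possible reflection \<open>\<ee>\<^sub>1 \<mapsto> - \<ee>\<^sub>1\<close>.\<close>

lemma isometry_fixing_eq_parabolic:
  assumes "lorentz_isometry h" "h \<vv> = \<vv>" "h \<ee>\<^sub>2 = \<ee>\<^sub>2"
  shows "h \<circ> h = parabolic (mink (h (h \<oo>)) \<ee>\<^sub>1)"
proof
  fix x
  have iso: "mink (h x) (h y) = mink x y" and lin: "linear h" for x y
    using assms by (auto simp: lorentz_isometry_def)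
  have orth: "mink (h x) \<vv> = mink x \<vv>" "mink (h x) \<ee>\<^sub>2 = mink x \<ee>\<^sub>2" for x
    using iso[of x \<vv>] iso[of x \<ee>\<^sub>2] assms by auto
  \<comment> \<open>The image of \<open>\<ee>\<^sub>1\<close> stays orthogonal to
    \<open>\<vv>\<close> and \<open>\<ee>\<^sub>2\<close>, which excludes components along
    \<open>\<oo>\<close> and \<open>\<ee>\<^sub>2\<close>.\<close>
  obtain k l where he: "h \<ee>\<^sub>1 = k *\<^sub>R \<vv> + l *\<^sub>R \<ee>\<^sub>1"
    using expansion[of "h \<ee>\<^sub>1"] orth[of \<ee>\<^sub>1] that[of "- mink (h \<ee>\<^sub>1) \<oo>" "mink (h \<ee>\<^sub>1) \<ee>\<^sub>1"] by simp
  have "l * l = 1"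
    using iso[of \<ee>\<^sub>1 \<ee>\<^sub>1] by (simp add: he mink_algebra)
  then have "h (h \<ee>\<^sub>1) = (k + l * k) *\<^sub>R \<vv> + \<ee>\<^sub>1"
    by (simp add: he linear_add[OF lin] linear_scale[OF lin] assms scaleR_add_right scaleR_add_left)
  then obtain \<theta> where \<theta>: "h (h \<ee>\<^sub>1) = \<theta> *\<^sub>R \<vv> + \<ee>\<^sub>1" by blast
  let ?o = "h (h \<oo>)"
  \<comment> \<open>These relations determine the image of \<open>\<oo>\<close> from \<theta>:
    orthogonality to the image of \<open>\<ee>\<^sub>1\<close> gives the component along
    \<open>\<ee>\<^sub>1\<close>, and being lightlike gives the one along
    \<open>\<vv>\<close>.\<close>
  have o: "mink ?o \<vv> = -1" "mink ?o \<ee>\<^sub>2 = 0" "mink ?o ?o = 0" "mink ?o (h (h \<ee>\<^sub>1)) = 0"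
    by (simp_all add: orth iso)
  then have oe: "mink ?o \<ee>\<^sub>1 = \<theta>" by (simp add: \<theta> mink_algebra)
  have oo: "mink ?o \<oo> = - \<theta>\<^sup>2 / 2"
    using mink_expansion[of ?o ?o] o by (simp add: oe power2_eq_square)
  have ho: "?o = (\<theta>\<^sup>2 / 2) *\<^sub>R \<vv> + \<theta> *\<^sub>R \<ee>\<^sub>1 + \<oo>"
    by (subst expansion) (simp add: o oe oo)
  have hx: "h (h x) = (- mink x \<oo>) *\<^sub>R \<vv> + mink x \<ee>\<^sub>1 *\<^sub>R h (h \<ee>\<^sub>1) + (- mink x \<vv>) *\<^sub>R ?o + mink x \<ee>\<^sub>2 *\<^sub>R \<ee>\<^sub>2"
    by (subst expansion[of x]) (simp only: linear_add[OF lin] linear_scale[OF lin] assms)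
  show "(h \<circ> h) x = parabolic (mink ?o \<ee>\<^sub>1) x"
    by (rule eq_if_mink_eq) (simp_all add: hx \<theta> ho mink_parabolic mink_algebra oe)
qed

end

text \<open>A Gram-Schmidt construction: a vector pairing to -1 with \<open>b\<close> is made
  orthogonal to \<open>a\<close>, then lightlike by adding a multiple of \<open>b\<close>. A vector
  orthogonal to all three is spacelike, because it is orthogonal to the timelike
  \<open>b + q\<close>.\<close>

lemma pseudo_orthonormal_basis_extend:
  assumes a: "mink a a = 1" and b: "mink b b = 0" "mink a b = 0" "b \<noteq> 0"
  obtains q f where "pseudo_orthonormal_basis b a q f"
proof -
  have b4: "b $ 4 \<noteq> 0"
    using causal_eq_zero b by force
  define y :: "real^4" where "y = (1 / b $ 4) *\<^sub>R axis 4 1"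
  have y: "mink b y = -1" using b4 by (simp add: y_def mink_def axis_def)
  define y' where "y' = y - mink y a *\<^sub>R a"
  have y': "mink b y' = -1" "mink a y' = 0"
    using y a b by (simp_all add: y'_def mink_algebra mink_commute)
  define q where "q = y' + (mink y' y' / 2) *\<^sub>R b"
  have q: "mink q q = 0" "mink b q = -1" "mink q a = 0"
    using y' a b by (simp_all add: q_def mink_algebra mink_commute)
  \<comment> \<open>\<open>J\<close> translates Minkowski orthogonality into Euclidean
    orthogonality, so that a dimension count yields the fourth vector.\<close>
  define J :: "real^4 \<Rightarrow> real^4" where "J = (\<lambda>y. \<chi> i. if i = 4 then - y $ i else y $ i)"
  have J: "x \<bullet> J y = mink x y" for x y
    by (auto simp: J_def mink_def inner_vec_def sum_4)
  have "dim {J b, J a, J q} \<le> card {J b, J a, J q}"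
    by (rule dim_le_card') simp
  also have "\<dots> \<le> 3" by (simp add: card_insert_if)
  finally have "dim {J b, J a, J q} < DIM(real^4)" by simp
  then obtain x where x: "x \<noteq> 0" "\<And>y. y \<in> span {J b, J a, J q} \<Longrightarrow> orthogonal x y"
    using orthogonal_to_subspace_exists by blast
  have xo: "mink x b = 0" "mink x a = 0" "mink x q = 0"
    using x(2)[of "J b"] x(2)[of "J a"] x(2)[of "J q"] 
    by (auto simp: orthogonal_def J span_base)
  have "mink (b + q) (b + q) < 0" "mink (b + q) x = 0"
    using b q xo by (simp_all add: mink_algebra mink_commute)
  then have pos: "mink x x > 0"
    using mink_strict_reversed_Cauchy_Schwarz[of "b + q" x] x(1) by force
  let ?f = "(1 / sqrt (mink x x)) *\<^sub>R x"
  have "mink ?f ?f = 1" using pos by (simp add: mink_algebra flip: real_sqrt_mult)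
  then have "pseudo_orthonormal_basis b a q ?f"
    using a b q xo by (simp add: pseudo_orthonormal_basis_def mink_algebra mink_commute)
  then show thesis by (rule that)
qed

text \<open>The range is an interval containing all integer multiples of \<open>f c\<close>, hence
  unbounded in both directions.\<close>

lemma surj_if_continuous_additive:
  fixes f :: "real \<Rightarrow> real"
  assumes add: "\<And>x y. f (x + y) = f x + f y" and cont: "continuous_on UNIV f" and "f c \<noteq> 0"
  shows "surj f"
proof -
  have f0: "f 0 = 0" using add[of 0 0] by simp
  have fn: "f (of_nat n * x) = of_nat n * f x" for n x
    by (induction n) (simp_all add: f0 add algebra_simps)
  have fm: "f (- x) = - f x" for x
    using add[of x "- x"] f0 by simp
  have iv: "is_interval (range f)"
    using connected_continuous_image[OF cont connected_UNIV] is_interval_connected_1 by blast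
  have "y \<in> range f" for y
  proof -
    obtain n where n: "\<bar>y\<bar> < of_nat n * \<bar>f c\<bar>"
      using \<open>f c \<noteq> 0\<close> ex_less_of_nat_mult[of "\<bar>f c\<bar>" "\<bar>y\<bar>"] by auto
    have "of_nat n * f c \<in> range f" "- (of_nat n * f c) \<in> range f"
      by (metis fn rangeI, metis fn fm rangeI)
    then have "of_nat n * \<bar>f c\<bar> \<in> range f" "- (of_nat n * \<bar>f c\<bar>) \<in> range f"
      by (auto simp: abs_if)
    then show ?thesis
      using n iv by (smt (verit) is_interval_1)
  qed
  then show ?thesis by blast
qed

text \<open>Each \<open>\<rho> s\<close> is the square of \<open>\<rho> (s/2)\<close>, hence
  parabolic with a parameter \<open>\<theta> s\<close>. This parameter is additive, continuous and
  not identically zero, so it takes every real value and the surface is invariant under the whole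
  parabolic group.\<close>

lemma parabolic_rotational_basis:
  assumes S: "parabolic_rotational S" "S \<subseteq> hyperbolic_space"
  obtains \<vv> \<ee>\<^sub>1 \<oo> \<ee>\<^sub>2 where "pseudo_orthonormal \<vv> \<ee>\<^sub>1 \<oo> \<ee>\<^sub>2" "\<And>x. x \<in> S \<Longrightarrow> mink x \<vv> < 0"
    "\<And>\<theta> x. x \<in> S \<Longrightarrow> pseudo_orthonormal.parabolic \<vv> \<ee>\<^sub>1 \<theta> x \<in> S"
proof -
  obtain P \<rho> where P: "signature_plus_zero P" and \<rho>: "one_parameter_group \<rho>"
    and \<rho>_id: "\<And>s x. (\<forall>y\<in>P. mink x y = 0) \<Longrightarrow> \<rho> s x = x" and inv: "\<And>s. \<rho> s ` S = S"
    using S(1) unfolding parabolic_rotational_def by blast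
  obtain a b where ab: "b \<noteq> 0" "mink a a = 1" "mink b b = 0" "mink a b = 0" "P = span {a, b}"
    using P unfolding signature_plus_zero_def by blast
  \<comment> \<open>The sign makes \<open>\<vv>\<close> future-directed, so that its product with
    points of hyperbolic space is negative.\<close>
  define \<vv> where "\<vv> = (if b $ 4 > 0 then b else - b)"
  have v: "\<vv> \<noteq> 0" "mink \<vv> \<vv> = 0" "mink a \<vv> = 0"
    using ab by (auto simp: \<vv>_def mink_algebra)
  obtain \<oo> \<ee>\<^sub>2 where pob: "pseudo_orthonormal_basis \<vv> a \<oo> \<ee>\<^sub>2"
    using pseudo_orthonormal_basis_extend[OF ab(2) v(2,3,1)] by blast
  then interpret pseudo_orthonormal \<vv> a \<oo> \<ee>\<^sub>2 by unfold_locales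
  have orthP: "\<forall>y\<in>P. mink x y = 0" if "mink x a = 0" "mink x \<vv> = 0" for x
  proof
    fix y assume "y \<in> P"
    then obtain k l where "y = k *\<^sub>R a + l *\<^sub>R b"
      unfolding ab(5) span_insert span_singleton by (auto simp: algebra_simps)
    then show "mink x y = 0"
      using that by (auto simp: \<vv>_def mink_algebra split: if_splits)
  qed
  \<comment> \<open>Both vectors are orthogonal to \<open>P\<close>; \<open>\<vv>\<close> spans its
    degenerate direction.\<close>
  have fixv: "\<rho> s \<vv> = \<vv>" and fixe: "\<rho> s \<ee>\<^sub>2 = \<ee>\<^sub>2" for s
    by (intro \<rho>_id orthP; simp)+
  have iso: "lorentz_isometry (\<rho> s)" and add: "\<rho> (s + t) = \<rho> s \<circ> \<rho> t" 
    and cont: "continuous_on UNIV (\<lambda>s. \<rho> s x)" for s t x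
    using \<rho> by (auto simp: one_parameter_group_def)
  define \<theta> where "\<theta> s = mink (\<rho> s \<oo>) a" for s
  have par: "\<rho> s = parabolic (\<theta> s)" for s
  proof -
    have *: "\<rho> (s/2) \<circ> \<rho> (s/2) = \<rho> s" using add[of "s/2" "s/2"] by simp
    then have **: "\<rho> (s/2) (\<rho> (s/2) \<oo>) = \<rho> s \<oo>" by (metis comp_apply)
    show ?thesis
      using isometry_fixing_eq_parabolic[OF iso fixv fixe, of "s/2"] unfolding * ** \<theta>_def .
  qed
  have "\<theta> (s + t) = \<theta> s + \<theta> t" for s t
  proof -
    have "mink (parabolic (\<theta> (s + t)) \<oo>) a = mink (parabolic (\<theta> s) (parabolic (\<theta> t) \<oo>)) a"
      using add[of s t] by (simp add: par)
    then show ?thesis by (simp add: mink_parabolic)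
  qed
  moreover have "continuous_on UNIV \<theta>"
    unfolding \<theta>_def by (intro mink.continuous_on cont continuous_intros)
  moreover obtain c where "\<theta> c \<noteq> 0"
  proof -
    obtain s where "\<rho> s \<noteq> id" using \<rho> by (auto simp: one_parameter_group_def)
    then have "\<theta> s \<noteq> 0" by (auto simp: par parabolic_def fun_eq_iff)
    then show thesis by (rule that)
  qed
  ultimately have "surj \<theta>" by (rule surj_if_continuous_additive)
  have "parabolic \<eta> x \<in> S" if "x \<in> S" for \<eta> x
  proof -
    obtain s where "\<eta> = \<theta> s" using \<open>surj \<theta>\<close> by blast
    then show ?thesis using inv[of s] that by (auto simp: par)
  qed
  moreover have "mink x \<vv> < 0" if "x \<in> S" for x
  proof -
    have "\<vv> $ 4 \<noteq> 0"
      using causal_eq_zero v by force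
    then have "\<vv> $ 4 > 0" by (auto simp: \<vv>_def split: if_splits)
    then show ?thesis
      using mink_future_neg[of x \<vv>] that S(2) v by (auto simp: hyperbolic_space_def)
  qed
  ultimately show thesis
    using that[of \<vv> a \<oo> \<ee>\<^sub>2] pseudo_orthonormal_axioms by blast
qed

section \<open>Elliptic integrals and the profile equation\<close>

lemma has_real_derivative_interval_integral:
  fixes f :: "real \<Rightarrow> real"
  assumes "continuous_on UNIV f"
  shows "((\<lambda>x. LBINT u=0..x. f u) has_real_derivative f x) (at x)"
proof -
  \<comment> \<open>The interval has both 0 and \<open>x\<close> in its interior, whatever the sign
    of \<open>x\<close>.\<close>
  let ?a = "- \<bar>x\<bar> - 1" and ?b = "\<bar>x\<bar> + 1"
  have "((\<lambda>x. LBINT u=ereal 0..ereal x. f u) has_vector_derivative f x) (at x within {?a..?b})"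
    by (rule interval_integral_FTC2) (auto intro: continuous_on_subset[OF assms])
  moreover have "at x within {?a..?b} = at x"
    by (rule at_within_Icc_at) auto
  ultimately show ?thesis
    by (simp add: has_real_derivative_iff_has_vector_derivative zero_ereal_def)
qed

lemma elliptic_radicand_pos:
  fixes p u :: real
  assumes "p\<^sup>2 < 1"
  shows "0 < 1 - p\<^sup>2 * (sin u)\<^sup>2"
proof -
  have "p\<^sup>2 * (sin u)\<^sup>2 \<le> p\<^sup>2 * 1"
    by (intro mult_left_mono) (auto simp: abs_square_le_1)
  with assms show ?thesis by simp
qed

lemma elliptic_F_has_real_derivative:
  assumes "p\<^sup>2 < 1"
  shows "(elliptic_F p has_real_derivative 1 / sqrt (1 - p\<^sup>2 * (sin x)\<^sup>2)) (at x)"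
  unfolding elliptic_F_def
  by (rule has_real_derivative_interval_integral)
    (use elliptic_radicand_pos[OF assms] in \<open>auto intro!: continuous_intros simp: less_imp_neq[symmetric]\<close>)

lemma elliptic_E_has_real_derivative:
  "(elliptic_E p has_real_derivative sqrt (1 - p\<^sup>2 * (sin x)\<^sup>2)) (at x)"
  unfolding elliptic_E_def
  by (rule has_real_derivative_interval_integral) (intro continuous_intros)

text \<open>The integrand is positive, so \<open>elliptic_F p\<close> is strictly increasing and
  \<open>x\<close> is its only preimage.\<close>

lemma jacobi_am_elliptic_F:
  assumes "p\<^sup>2 < 1"
  shows "jacobi_am p (elliptic_F p x) = x"
proof -
  have "elliptic_F p x < elliptic_F p y" if "x < y" for x y
    using that
  proof (rule DERIV_pos_imp_increasing)
    fix z
    show "\<exists>D. (elliptic_F p has_real_derivative D) (at z) \<and> D > 0"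
      using elliptic_F_has_real_derivative[OF assms, of z] elliptic_radicand_pos[OF assms, of z]
      by (intro exI[of _ "1 / sqrt (1 - p\<^sup>2 * (sin z)\<^sup>2)"]) simp
  qed
  then have "y = x" if "elliptic_F p y = elliptic_F p x" for y
    using that by (metis less_irrefl linorder_neqE_linordered_idom)
  then show ?thesis
    unfolding jacobi_am_def by (intro the_equality) auto
qed

lemma profile_curve_pos:
  fixes z \<psi> A B :: "'a::real_normed_vector \<Rightarrow> real"
  assumes U: "open U" "connected U" "U \<noteq> {}"
    and H: "\<bar>H\<bar> < 1" and C: "C > 0"
    and z: "\<And>u. u \<in> U \<Longrightarrow> (z has_derivative dz u) (at u)" "\<And>u. u \<in> U \<Longrightarrow> z u > 0"
    and \<psi>: "\<And>u. u \<in> U \<Longrightarrow> (\<psi> has_derivative d\<psi> u) (at u)"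
    and A: "\<And>u. u \<in> U \<Longrightarrow> (A has_derivative (\<lambda>w. - 2 * C * z u * dz u w)) (at u)"
    and B: "\<And>u. u \<in> U \<Longrightarrow> (B has_derivative (\<lambda>w. - 2 * C * z u * d\<psi> u w)) (at u)"
    and A_eq: "\<And>u. u \<in> U \<Longrightarrow> A u = H - C * (z u)\<^sup>2"
    and unit: "\<And>u. u \<in> U \<Longrightarrow> (A u)\<^sup>2 + (B u)\<^sup>2 = 1"
    and normal: "\<And>u w. u \<in> U \<Longrightarrow> B u * d\<psi> u w + A u * dz u w = 0"
  shows "\<exists>t \<psi>\<^sub>0. \<forall>u\<in>U. (t has_derivative (\<lambda>w. A u * d\<psi> u w - B u * dz u w)) (at u) \<and>
    jacobi_cn (cmc_modulus H C) (cmc_Xi C * t u) > 0 \<and>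
    1 / z u = cmc_r H C (t u) \<and> \<psi> u = cmc_psi H C (t u) + \<psi>\<^sub>0"
proof -
  define p where "p = cmc_modulus H C"
  define \<Xi> where "\<Xi> = cmc_Xi C"
  have p: "p\<^sup>2 = (1 + H) / 2" and p1: "p\<^sup>2 < 1"
    using H C by (auto simp: p_def cmc_modulus_def)
  have \<Xi>: "\<Xi> > 0" "\<Xi> = sqrt (2 * C)"
    using C by (auto simp: \<Xi>_def cmc_Xi_def)
  define k where "k = 1 / sqrt (1 + H)"
  have k: "k > 0" "k\<^sup>2 = 1 / (1 + H)"
    using H by (auto simp: k_def power_divide)
  define s where "s u = B u * (k / sqrt (1 - A u))" for u
  define \<phi> where "\<phi> u = arcsin (s u)" for u
  \<comment> \<open>In the (\<psi>, z) plane the unit tangent of the profile is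
    \<open>(A, - B)\<close>.\<close>
  define \<mu> where "\<mu> u w = A u * d\<psi> u w - B u * dz u w" for u w
  define t where "t u = elliptic_F p (\<phi> u) / \<Xi>" for u
  \<comment> \<open>The difference between \<open>\<psi>\<close> and the claimed
    \<open>cmc_psi H C (t u)\<close>, expressed through the amplitude \<open>\<phi>\<close>.\<close>
  define g where "g u = \<psi> u - (elliptic_F p (\<phi> u) - 2 * elliptic_E p (\<phi> u)) / \<Xi>" for u
  have A1: "A u < 1" if "u \<in> U" for u
    using A_eq[OF that] H C z(2)[OF that] zero_le_power2[of "z u"]
    by (smt (verit) mult_nonneg_nonneg)
  have s2: "1 - (s u)\<^sup>2 = C * (z u)\<^sup>2 / (1 + H)" if "u \<in> U" for u
  proof -
    have "(s u)\<^sup>2 = (B u)\<^sup>2 * (1 / (1 + H) / (1 - A u))"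
      using A1[OF that] k(2) by (simp add: s_def power_mult_distrib power_divide)
    also have "(B u)\<^sup>2 = (1 - A u) * (1 + A u)"
      using unit[OF that] by (simp add: power2_eq_square algebra_simps)
    also have "(1 - A u) * (1 + A u) * (1 / (1 + H) / (1 - A u)) = (1 + A u) / (1 + H)"
      using A1[OF that] by simp
    finally show ?thesis
      using H A_eq[OF that] by (simp add: field_simps)
  qed
  have cz: "C * (z u)\<^sup>2 / (1 + H) > 0" if "u \<in> U" for u
    using C H z(2)[OF that] by simp
  \<comment> \<open>The strict bounds, due to \<open>z u > 0\<close>, keep \<open>s u\<close> where
    arcsin is differentiable.\<close>
  have s1: "-1 < s u" "s u < 1" if "u \<in> U" for u
    using s2[OF that] cz[OF that] abs_square_less_1[of "s u"] by auto
  have sin\<phi>: "sin (\<phi> u) = s u" if "u \<in> U" for u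
    using s1[OF that] by (simp add: \<phi>_def)
  have cos\<phi>: "cos (\<phi> u) = sqrt C * k * z u" if "u \<in> U" for u
  proof -
    have "cos (\<phi> u) = sqrt (1 - (s u)\<^sup>2)"
      unfolding \<phi>_def using s1[OF that] by (intro cos_arcsin) auto
    also have "\<dots> = sqrt C * k * z u"
      using z(2)[OF that] by (simp add: s2[OF that] real_sqrt_mult real_sqrt_divide k_def)
    finally show ?thesis .
  qed
  \<comment> \<open>The square of the Jacobi function dn at the amplitude
    \<open>\<phi> u\<close>.\<close>
  have \<Delta>: "1 - p\<^sup>2 * (sin (\<phi> u))\<^sup>2 = (1 - A u) / 2" if "u \<in> U" for u
  proof -
    have "(s u)\<^sup>2 = 1 - C * (z u)\<^sup>2 / (1 + H)" using s2[OF that] by simp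
    then show ?thesis
      unfolding sin\<phi>[OF that] p using H by (simp add: A_eq[OF that] field_simps)
  qed
  have d\<psi>: "d\<psi> u w = A u * \<mu> u w" and dz: "dz u w = - B u * \<mu> u w" if "u \<in> U" for u w
    using unit[OF that] normal[OF that, of w] unfolding \<mu>_def by algebra+
  have ds: "(s has_derivative (\<lambda>w. C * k * z u * sqrt (1 - A u) * \<mu> u w)) (at u)" if "u \<in> U" for u
  proof -
    define q where "q = sqrt (1 - A u)"
    have q: "q > 0" "q * q = 1 - A u" using A1[OF that] by (auto simp: q_def)
    have "((\<lambda>a. k / sqrt (1 - a)) has_real_derivative k / (2 * (q * q * q))) (at (A u))"
      using q unfolding q_def
      by (auto intro!: derivative_eq_intros simp: field_simps)
    from DERIV_compose_FDERIV[OF this A[OF that]]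
    have "(s has_derivative (\<lambda>w. B u * (- 2 * C * z u * dz u w * (k / (2 * (q * q * q))))
        + - 2 * C * z u * d\<psi> u w * (k / q))) (at u)"
      unfolding s_def q_def using has_derivative_mult[OF B[OF that]] by blast
    moreover have "B u * (- 2 * C * z u * dz u w * (k / (2 * (q * q * q))))
        + - 2 * C * z u * d\<psi> u w * (k / q) = C * k * z u * q * \<mu> u w" for w
    proof -
      have "B u * (- 2 * C * z u * dz u w * (k / (2 * (q * q * q))))
          + - 2 * C * z u * d\<psi> u w * (k / q)
        = C * k * z u * \<mu> u w * ((B u)\<^sup>2 - 2 * A u * (q * q)) / (q * q * q)"
        using q(1) by (simp add: dz[OF that] d\<psi>[OF that] field_simps power2_eq_square)
      \<comment> \<open>As \<open>q * q\<close> is 1 - A and the squares of A and B sum to 1, both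
        sides equal the square of 1 - A.\<close>
      also have "(B u)\<^sup>2 - 2 * A u * (q * q) = (q * q) * (q * q)"
        unfolding q(2) using unit[OF that] by algebra
      finally show ?thesis using q(1) by simp
    qed
    ultimately show ?thesis by (simp add: q_def)
  qed
  have d\<phi>: "(\<phi> has_derivative (\<lambda>w. \<Xi> * sqrt ((1 - A u) / 2) * \<mu> u w)) (at u)" if "u \<in> U" for u
  proof -
    have c: "sqrt (1 - (s u)\<^sup>2) = sqrt C * k * z u"
      using cos\<phi>[OF that] cos_arcsin[of "s u"] s1[OF that] by (simp add: \<phi>_def)
    have "(arcsin has_real_derivative inverse (sqrt (1 - (s u)\<^sup>2))) (at (s u))"
      using s1[OF that] by (intro DERIV_arcsin) auto
    from DERIV_compose_FDERIV[OF this ds[OF that]]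
    have "(\<phi> has_derivative (\<lambda>w. C * k * z u * sqrt (1 - A u) * \<mu> u w * inverse (sqrt C * k * z u))) (at u)"
      unfolding \<phi>_def c .
    moreover have "C * k * z u * sqrt (1 - A u) * x * inverse (sqrt C * k * z u)
      = \<Xi> * sqrt ((1 - A u) / 2) * x" for x
    proof -
      have "C * inverse (sqrt C) = sqrt C"
        using C by (simp add: real_div_sqrt flip: divide_inverse)
      moreover have "\<Xi> * sqrt ((1 - A u) / 2) = sqrt C * sqrt (1 - A u)"
        by (simp add: \<Xi>(2) real_sqrt_mult real_sqrt_divide)
      moreover have "C * k * z u * sqrt (1 - A u) * x * inverse (sqrt C * k * z u)
        = C * inverse (sqrt C) * sqrt (1 - A u) * x"
        using k(1) z(2)[OF that] by (simp add: field_simps)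
      ultimately show ?thesis by simp
    qed
    ultimately show ?thesis by (simp only:)
  qed
  \<comment> \<open>The derivative of F cancels the square root in \<open>d\<phi>\<close>, leaving a
    constant multiple of arc length; for E the root is squared instead.\<close>
  have dF: "((\<lambda>u. elliptic_F p (\<phi> u)) has_derivative (\<lambda>w. \<Xi> * \<mu> u w)) (at u)" if "u \<in> U" for u
    using DERIV_compose_FDERIV[OF elliptic_F_has_real_derivative[OF p1] d\<phi>[OF that]] A1[OF that]
    by (simp add: \<Delta>[OF that] field_simps)
  have dE: "((\<lambda>u. elliptic_E p (\<phi> u)) has_derivative (\<lambda>w. \<Xi> * ((1 - A u) / 2) * \<mu> u w)) (at u)" if "u \<in> U" for u
  proof -
    have "sqrt ((1 - A u) / 2) * sqrt ((1 - A u) / 2) = (1 - A u) / 2"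
      using A1[OF that] by simp
    then have *: "\<Xi> * sqrt ((1 - A u) / 2) * x * sqrt ((1 - A u) / 2) = \<Xi> * ((1 - A u) / 2) * x" for x
      by (metis mult.assoc mult.commute)
    show ?thesis
      using DERIV_compose_FDERIV[OF elliptic_E_has_real_derivative d\<phi>[OF that], of p]
      unfolding \<Delta>[OF that] * .
  qed
  have dt: "(t has_derivative \<mu> u) (at u)" if "u \<in> U" for u
    unfolding t_def using has_derivative_mult_right[OF dF[OF that], of "1 / \<Xi>"] \<Xi>(1) by simp
  \<comment> \<open>The derivative of t - 2 E / \<Xi> is (1 - (1 - A)) \<mu> = A \<mu>, which is
    \<open>d\<psi>\<close>.\<close>
  have dg: "(g has_derivative (\<lambda>w. 0)) (at u)" if "u \<in> U" for u
  proof -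
    have "(g has_derivative (\<lambda>w. d\<psi> u w - 1 / \<Xi> * (\<Xi> * \<mu> u w - 2 * (\<Xi> * ((1 - A u) / 2) * \<mu> u w)))) (at u)"
      unfolding g_def
      using has_derivative_diff[OF \<psi>[OF that] has_derivative_mult_right[OF
          has_derivative_diff[OF dF[OF that] has_derivative_mult_right[OF dE[OF that], of 2]], of "1 / \<Xi>"]]
      by simp
    moreover have "d\<psi> u w - 1 / \<Xi> * (\<Xi> * \<mu> u w - 2 * (\<Xi> * ((1 - A u) / 2) * \<mu> u w)) = 0" for w
      using \<Xi>(1) by (simp add: d\<psi>[OF that] field_simps)
    ultimately show ?thesis by simp
  qed
  obtain u0 where u0: "u0 \<in> U" using U(3) by blast
  have "g u = g u0" if "u \<in> U" for u
    using has_derivative_zero_unique_connected[OF U(1,2) dg that u0] .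
  moreover have am: "jacobi_am p (\<Xi> * t u) = \<phi> u" for u
    using jacobi_am_elliptic_F[OF p1] \<Xi>(1) by (simp add: t_def)
  then have "cmc_psi H C (t u) = \<psi> u - g u" for u
    using \<Xi>(1) by (simp add: cmc_psi_def flip: p_def \<Xi>_def) (simp add: t_def g_def diff_divide_distrib)
  moreover have cn: "jacobi_cn p (\<Xi> * t u) = sqrt C * k * z u" if "u \<in> U" for u
    using am cos\<phi>[OF that] by (simp add: jacobi_cn_def)
  then have "1 / z u = cmc_r H C (t u)" if "u \<in> U" for u
    using C H that by (simp add: cmc_r_def C_plus_def k_def real_sqrt_divide add.commute flip: p_def \<Xi>_def)
  ultimately show ?thesis
    using dt cn C k(1) z(2)
    by (intro exI[of _ t] exI[of _ "g u0"]) (auto simp: \<mu>_def[abs_def] simp flip: p_def \<Xi>_def)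
qed

text \<open>For negative \<open>C\<close> the positive candidate is C / (H - 1), which is (-C) / (-H
  + 1), and the modulus formula with 1 - H is the one for positive constants with \<open>H\<close>
  negated.\<close>

lemma cmc_parameters_uminus:
  assumes "\<bar>H\<bar> < 1" "C < 0"
  shows "cmc_modulus (- H) (- C) = cmc_modulus H C" "cmc_Xi (- C) = cmc_Xi C"
    "cmc_r (- H) (- C) = cmc_r H C" "cmc_psi (- H) (- C) = cmc_psi H C"
proof -
  show *: "cmc_modulus (- H) (- C) = cmc_modulus H C" "cmc_Xi (- C) = cmc_Xi C"
    using assms by (simp_all add: cmc_modulus_def cmc_Xi_def)
  have "C / (H + 1) < 0" "- C / (- H + 1) > 0" "- C / (- H + 1) = C / (H - 1)"
    using assms by (auto simp: divide_neg_pos field_simps)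
  then have "C_plus (- H) (- C) = C_plus H C"
    unfolding C_plus_def by auto
  with * show "cmc_r (- H) (- C) = cmc_r H C" "cmc_psi (- H) (- C) = cmc_psi H C"
    by (simp_all add: fun_eq_iff cmc_r_def cmc_psi_def)
qed

text \<open>Negating A and B flips \<open>H\<close> and \<open>C\<close>. It also reverses the
  tangent \<open>(A, - B)\<close>, whence the factor \<open>sgn C\<close> in the derivative of
  \<open>t\<close>.\<close>

lemma profile_curve:
  fixes z \<psi> A B :: "'a::real_normed_vector \<Rightarrow> real"
  assumes U: "open U" "connected U" "U \<noteq> {}"
    and H: "\<bar>H\<bar> < 1" and C: "C \<noteq> 0"
    and z: "\<And>u. u \<in> U \<Longrightarrow> (z has_derivative dz u) (at u)" "\<And>u. u \<in> U \<Longrightarrow> z u > 0"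
    and \<psi>: "\<And>u. u \<in> U \<Longrightarrow> (\<psi> has_derivative d\<psi> u) (at u)"
    and A: "\<And>u. u \<in> U \<Longrightarrow> (A has_derivative (\<lambda>w. - 2 * C * z u * dz u w)) (at u)"
    and B: "\<And>u. u \<in> U \<Longrightarrow> (B has_derivative (\<lambda>w. - 2 * C * z u * d\<psi> u w)) (at u)"
    and A_eq: "\<And>u. u \<in> U \<Longrightarrow> A u = H - C * (z u)\<^sup>2"
    and unit: "\<And>u. u \<in> U \<Longrightarrow> (A u)\<^sup>2 + (B u)\<^sup>2 = 1"
    and normal: "\<And>u w. u \<in> U \<Longrightarrow> B u * d\<psi> u w + A u * dz u w = 0"
  shows "\<exists>t \<psi>\<^sub>0. \<forall>u\<in>U. (t has_derivative (\<lambda>w. sgn C * (A u * d\<psi> u w - B u * dz u w))) (at u) \<and>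
    jacobi_cn (cmc_modulus H C) (cmc_Xi C * t u) > 0 \<and>
    1 / z u = cmc_r H C (t u) \<and> \<psi> u = cmc_psi H C (t u) + \<psi>\<^sub>0"
proof (cases "C > 0")
  case True
  then show ?thesis
    using profile_curve_pos[OF U H True z \<psi> A B A_eq unit normal] by simp
next
  case False
  with C have neg: "C < 0" by simp
  let ?A = "\<lambda>u. - A u" and ?B = "\<lambda>u. - B u"
  have "\<exists>t \<psi>\<^sub>0. \<forall>u\<in>U. (t has_derivative (\<lambda>w. ?A u * d\<psi> u w - ?B u * dz u w)) (at u) \<and>
    jacobi_cn (cmc_modulus (- H) (- C)) (cmc_Xi (- C) * t u) > 0 \<and>
    1 / z u = cmc_r (- H) (- C) (t u) \<and> \<psi> u = cmc_psi (- H) (- C) (t u) + \<psi>\<^sub>0"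
  proof (rule profile_curve_pos[OF U, where z = z and \<psi> = \<psi> and A = ?A and B = ?B])
    show "(?A has_derivative (\<lambda>w. - 2 * - C * z u * dz u w)) (at u)" if "u \<in> U" for u
      using has_derivative_minus[OF A[OF that]] by simp
    show "(?B has_derivative (\<lambda>w. - 2 * - C * z u * d\<psi> u w)) (at u)" if "u \<in> U" for u
      using has_derivative_minus[OF B[OF that]] by simp
    show "?B u * d\<psi> u w + ?A u * dz u w = 0" if "u \<in> U" for u w
      using normal[OF that, of w] by simp
    show "(?A u)\<^sup>2 + (?B u)\<^sup>2 = 1" if "u \<in> U" for u
      using unit[OF that] by simp
  qed (use H neg z \<psi> A_eq in auto)
  then show ?thesis
    using neg by (simp add: cmc_parameters_uminus[OF H neg] algebra_simps)
qed

section \<open>Half-space coordinates\<close>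

text \<open>
  Upper half-space coordinates \<open>(\<theta>, \<psi>, z)\<close> with metric \<open>(d\<theta>\<^sup>2 + d\<psi>\<^sup>2 + dz\<^sup>2) / z\<^sup>2\<close>, where \<open>z = 1 / r\<close>,
  and the components of tangent vectors at \<open>x\<close> in the orthonormal frame \<open>z \<partial>\<^sub>\<theta>, z \<partial>\<^sub>\<psi>, z \<partial>\<^sub>z\<close>.
\<close>

context pseudo_orthonormal
begin

definition height :: "real^4 \<Rightarrow> real" where "height x = - 1 / mink x \<vv>"
definition coord_\<theta> :: "real^4 \<Rightarrow> real" where "coord_\<theta> x = - mink x \<ee>\<^sub>1 / mink x \<vv>"
definition coord_\<psi> :: "real^4 \<Rightarrow> real" where "coord_\<psi> x = - mink x \<ee>\<^sub>2 / mink x \<vv>"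

definition frame_\<theta> :: "real^4 \<Rightarrow> real^4 \<Rightarrow> real" where
  "frame_\<theta> x y = mink y \<ee>\<^sub>1 + coord_\<theta> x * mink y \<vv>"
definition frame_\<psi> :: "real^4 \<Rightarrow> real^4 \<Rightarrow> real" where
  "frame_\<psi> x y = mink y \<ee>\<^sub>2 + coord_\<psi> x * mink y \<vv>"
definition frame_z :: "real^4 \<Rightarrow> real^4 \<Rightarrow> real" where
  "frame_z x y = height x * mink y \<vv>"

lemmas frame_defs = frame_\<theta>_def frame_\<psi>_def frame_z_def

lemma frame_scaleR:
  "frame_\<theta> x (k *\<^sub>R y) = k * frame_\<theta> x y" "frame_\<psi> x (k *\<^sub>R y) = k * frame_\<psi> x y"
  "frame_z x (k *\<^sub>R y) = k * frame_z x y"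
  by (simp_all add: frame_defs mink_algebra algebra_simps)

lemma frame_add:
  "frame_\<theta> x (y + y') = frame_\<theta> x y + frame_\<theta> x y'" "frame_\<psi> x (y + y') = frame_\<psi> x y + frame_\<psi> x y'"
  "frame_z x (y + y') = frame_z x y + frame_z x y'"
  by (simp_all add: frame_defs mink_algebra algebra_simps)

lemma coord_parabolic:
  assumes "mink x \<vv> \<noteq> 0"
  shows "height (parabolic \<eta> x) = height x" "coord_\<psi> (parabolic \<eta> x) = coord_\<psi> x"
    "coord_\<theta> (parabolic \<eta> x) = coord_\<theta> x + \<eta>"
  using assms by (simp_all add: height_def coord_\<theta>_def coord_\<psi>_def mink_parabolic field_simps)

text \<open>This is the parametrization of the theorem at a single point; the coefficient of
  \<open>\<vv>\<close> is forced by \<open>mink x x = -1\<close>.\<close>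

lemma coord_expansion:
  assumes x: "mink x x = -1" "mink x \<vv> < 0" and r: "r = 1 / height x"
  shows "x = ((1 + r\<^sup>2 * ((coord_\<psi> x)\<^sup>2 + (coord_\<theta> x)\<^sup>2)) / (2 * r)) *\<^sub>R \<vv> + (r * coord_\<theta> x) *\<^sub>R \<ee>\<^sub>1
    + r *\<^sub>R \<oo> + (r * coord_\<psi> x) *\<^sub>R \<ee>\<^sub>2"
proof -
  have r': "r = - mink x \<vv>" using r by (simp add: height_def)
  have 1: "r * coord_\<theta> x = mink x \<ee>\<^sub>1" "r * coord_\<psi> x = mink x \<ee>\<^sub>2"
    using x by (simp_all add: r' coord_\<theta>_def coord_\<psi>_def)
  have "r\<^sup>2 * ((coord_\<psi> x)\<^sup>2 + (coord_\<theta> x)\<^sup>2) = (mink x \<ee>\<^sub>2)\<^sup>2 + (mink x \<ee>\<^sub>1)\<^sup>2"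
    unfolding 1[symmetric] by algebra
  then have "(1 + r\<^sup>2 * ((coord_\<psi> x)\<^sup>2 + (coord_\<theta> x)\<^sup>2)) / (2 * r) = - mink x \<oo>"
    using x mink_expansion[of x x] by (simp add: r' field_simps power2_eq_square)
  then show ?thesis
    unfolding 1 by (subst (1) expansion) (simp add: r')
qed

lemma mink_frame:
  assumes x: "mink x x = -1" "mink x \<vv> \<noteq> 0" and y: "mink x y = 0" "mink x y' = 0"
  shows "mink y y' = frame_\<theta> x y * frame_\<theta> x y' + frame_\<psi> x y * frame_\<psi> x y' + frame_z x y * frame_z x y'"
proof -
  define r where "r = - mink x \<vv>"
  define \<theta> where "\<theta> = coord_\<theta> x"
  define \<psi> where "\<psi> = coord_\<psi> x"
  have r: "r \<noteq> 0" and xv: "mink x \<vv> = - r" and h: "height x = 1 / r"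
    using x by (auto simp: r_def height_def)
  have x1: "mink x \<ee>\<^sub>1 = r * \<theta>" "mink x \<ee>\<^sub>2 = r * \<psi>"
    using x by (simp_all add: r_def \<theta>_def \<psi>_def coord_\<theta>_def coord_\<psi>_def)
  have xo: "mink x \<oo> = - (1 / r + r * \<theta>\<^sup>2 + r * \<psi>\<^sup>2) / 2"
    using x(1) r unfolding mink_expansion[of x x] x1 xv by (simp add: field_simps power2_eq_square)
  \<comment> \<open>Tangency at \<open>x\<close> expresses the pairing with \<open>\<oo>\<close>
    through the other three, which is why three components suffice.\<close>
  have yo: "mink y \<oo> = mink x \<oo> / r * mink y \<vv> - \<theta> * mink y \<ee>\<^sub>1 - \<psi> * mink y \<ee>\<^sub>2" if "mink x y = 0" for y
    using that r unfolding mink_expansion[of x y] x1 xv by (simp add: field_simps)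
  show ?thesis
    unfolding mink_expansion[of y y'] yo[OF y(1)] yo[OF y(2)] xo frame_defs h \<theta>_def[symmetric] \<psi>_def[symmetric]
    using r by (simp add: field_simps power2_eq_square)
qed

lemma frame_eq_zero:
  assumes x: "mink x \<vv> \<noteq> 0" and y: "mink x y = 0"
    and "frame_\<theta> x y = 0" "frame_\<psi> x y = 0" "frame_z x y = 0"
  shows "y = 0"
proof -
  have "mink y \<vv> = 0" using assms by (simp add: frame_z_def height_def)
  with assms have "mink y \<ee>\<^sub>1 = 0" "mink y \<ee>\<^sub>2 = 0" by (simp_all add: frame_defs)
  with \<open>mink y \<vv> = 0\<close> x y have "mink y \<oo> = 0"
    unfolding mink_expansion[of x y] by simp
  then show ?thesis
    using \<open>mink y \<vv> = 0\<close> \<open>mink y \<ee>\<^sub>1 = 0\<close> \<open>mink y \<ee>\<^sub>2 = 0\<close> by (subst expansion) simp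
qed

text \<open>Identifies the frame components as the differentials of the coordinates divided by the
  height.\<close>

lemma has_derivative_coord:
  assumes f: "(f has_derivative f') (at u)" and "mink (f u) \<vv> \<noteq> 0"
  shows "((\<lambda>u. height (f u)) has_derivative (\<lambda>w. height (f u) * frame_z (f u) (f' w))) (at u)"
    "((\<lambda>u. coord_\<theta> (f u)) has_derivative (\<lambda>w. height (f u) * frame_\<theta> (f u) (f' w))) (at u)"
    "((\<lambda>u. coord_\<psi> (f u)) has_derivative (\<lambda>w. height (f u) * frame_\<psi> (f u) (f' w))) (at u)"
proof -
  have m: "((\<lambda>u. mink (f u) y) has_derivative (\<lambda>w. mink (f' w) y)) (at u)" for y
    using mink.FDERIV[OF f has_derivative_const] by (simp add: mink_algebra)
  have *: "((\<lambda>u. - mink (f u) y / mink (f u) \<vv>) has_derivative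
      (\<lambda>w. height (f u) * (mink (f' w) y + - mink (f u) y / mink (f u) \<vv> * mink (f' w) \<vv>))) (at u)" for y
    by (rule has_derivative_eq_rhs[OF has_derivative_divide'[OF has_derivative_minus[OF m] m]])
      (use assms in \<open>auto simp: height_def field_simps power2_eq_square\<close>)
  show "((\<lambda>u. coord_\<theta> (f u)) has_derivative (\<lambda>w. height (f u) * frame_\<theta> (f u) (f' w))) (at u)"
    "((\<lambda>u. coord_\<psi> (f u)) has_derivative (\<lambda>w. height (f u) * frame_\<psi> (f u) (f' w))) (at u)"
    unfolding coord_\<theta>_def coord_\<psi>_def frame_defs using * by blast+
  show "((\<lambda>u. height (f u)) has_derivative (\<lambda>w. height (f u) * frame_z (f u) (f' w))) (at u)"
    unfolding height_def frame_defs
    by (rule has_derivative_eq_rhs[OF has_derivative_divide'[OF has_derivative_const m]])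
      (use assms in \<open>auto simp: height_def field_simps power2_eq_square\<close>)
qed

text \<open>The frame moves with the base point \<open>f u\<close>; differentiating it produces the
  terms with the factor \<open>frame_z (f u) (g u)\<close>. For the unit normal this factor is
  A.\<close>

lemma has_derivative_frame:
  assumes f: "(f has_derivative f') (at u)" "mink (f u) \<vv> \<noteq> 0" and g: "(g has_derivative g') (at u)"
  shows "((\<lambda>u. frame_z (f u) (g u)) has_derivative
      (\<lambda>w. frame_z (f u) (g u) * frame_z (f u) (f' w) + frame_z (f u) (g' w))) (at u)"
    "((\<lambda>u. frame_\<theta> (f u) (g u)) has_derivative
      (\<lambda>w. frame_z (f u) (g u) * frame_\<theta> (f u) (f' w) + frame_\<theta> (f u) (g' w))) (at u)"
    "((\<lambda>u. frame_\<psi> (f u) (g u)) has_derivative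
      (\<lambda>w. frame_z (f u) (g u) * frame_\<psi> (f u) (f' w) + frame_\<psi> (f u) (g' w))) (at u)"
proof -
  have m: "((\<lambda>u. mink (g u) y) has_derivative (\<lambda>w. mink (g' w) y)) (at u)" for y
    using mink.FDERIV[OF g has_derivative_const] by (simp add: mink_algebra)
  note d = has_derivative_coord[OF f]
  show "((\<lambda>u. frame_z (f u) (g u)) has_derivative
      (\<lambda>w. frame_z (f u) (g u) * frame_z (f u) (f' w) + frame_z (f u) (g' w))) (at u)"
    unfolding frame_z_def[of "f _" "g _"]
    by (rule has_derivative_eq_rhs[OF has_derivative_mult[OF d(1) m]])
      (auto simp: frame_z_def algebra_simps)
  show "((\<lambda>u. frame_\<theta> (f u) (g u)) has_derivative
      (\<lambda>w. frame_z (f u) (g u) * frame_\<theta> (f u) (f' w) + frame_\<theta> (f u) (g' w))) (at u)"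
    unfolding frame_\<theta>_def[of "f _" "g _"]
    by (rule has_derivative_eq_rhs[OF has_derivative_add[OF m has_derivative_mult[OF d(2) m]]])
      (auto simp: frame_defs algebra_simps)
  show "((\<lambda>u. frame_\<psi> (f u) (g u)) has_derivative
      (\<lambda>w. frame_z (f u) (g u) * frame_\<psi> (f u) (f' w) + frame_\<psi> (f u) (g' w))) (at u)"
    unfolding frame_\<psi>_def[of "f _" "g _"]
    by (rule has_derivative_eq_rhs[OF has_derivative_add[OF m has_derivative_mult[OF d(3) m]]])
      (auto simp: frame_defs algebra_simps)
qed

text \<open>The parabolic rotation in the plane of \<open>\<vv>\<close> and
  \<open>\<ee>\<^sub>2\<close> applied to the basis. It lowers the \<psi> coordinate by
  \<open>s\<close>, which serves to absorb an additive constant.\<close>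

lemma shifted_basis:
  "pseudo_orthonormal_basis \<vv> \<ee>\<^sub>1 (\<oo> + s *\<^sub>R \<ee>\<^sub>2 + (s\<^sup>2 / 2) *\<^sub>R \<vv>) (\<ee>\<^sub>2 + s *\<^sub>R \<vv>)"
  by (simp add: pseudo_orthonormal_basis_def mink_algebra power2_eq_square)

end

text \<open>The triples (a, b, c) are the \<theta>, \<psi>, z components of two orthonormal
  principal directions, and the normal has components (0, B, A). Either both curvatures equal A, or
  one direction is tangent to the orbit and the other to the profile.\<close>

lemma principal_frame_algebra:
  fixes A B H :: real
  assumes AB: "A\<^sup>2 + B\<^sup>2 = 1" and n: "B * b1 + A * c1 = 0" "B * b2 + A * c2 = 0"
    and on: "a1 * a1 + b1 * b1 + c1 * c1 = 1" "a2 * a2 + b2 * b2 + c2 * c2 = 1" "a1 * a2 + b1 * b2 + c1 * c2 = 0"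
    and \<kappa>: "(A - \<kappa>1) * a1 = 0" "(A - \<kappa>2) * a2 = 0" "\<kappa>1 + \<kappa>2 = 2 * H"
  shows "(A - \<kappa>1) * b1 = 2 * (A - H) * b1 \<and> (A - \<kappa>1) * c1 = 2 * (A - H) * c1 \<and>
      (A - \<kappa>2) * b2 = 2 * (A - H) * b2 \<and> (A - \<kappa>2) * c2 = 2 * (A - H) * c2 \<and>
      (A = H \<longrightarrow> \<kappa>1 = H \<and> \<kappa>2 = H) \<and> (A * b1 - B * c1 \<noteq> 0 \<or> A * b2 - B * c2 \<noteq> 0)"
proof -
  \<comment> \<open>Components along the profile tangent \<open>(A, - B)\<close>; the pairs (a1, l1)
    and (a2, l2) are orthonormal in the plane.\<close>
  define l1 where "l1 = A * b1 - B * c1"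
  define l2 where "l2 = A * b2 - B * c2"
  have bc: "b1 = A * l1" "c1 = - B * l1" "b2 = A * l2" "c2 = - B * l2"
    using AB n unfolding l1_def l2_def by algebra+
  have L: "a1 * a1 + l1 * l1 = 1" "a2 * a2 + l2 * l2 = 1" "a1 * a2 + l1 * l2 = 0"
    using on AB unfolding bc by algebra+
  have l: "l1 \<noteq> 0 \<or> l2 \<noteq> 0" and a: "a1 \<noteq> 0 \<or> a2 \<noteq> 0"
    using L by auto
  have \<kappa>': "A = \<kappa>1 \<or> a1 = 0" "A = \<kappa>2 \<or> a2 = 0" using \<kappa> by auto
  have "(A - \<kappa>1) * l1 = 2 * (A - H) * l1 \<and> (A - \<kappa>2) * l2 = 2 * (A - H) * l2"
  proof (cases "a1 = 0")
    case True
    then have "l2 = 0" "A = \<kappa>2" using L \<kappa>'(2) a by auto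
    then show ?thesis using \<kappa>(3) by algebra
  next
    case False
    then have "A = \<kappa>1" using \<kappa>' by simp
    show ?thesis
    proof (cases "A = \<kappa>2")
      case True
      then show ?thesis using \<open>A = \<kappa>1\<close> \<kappa>(3) by simp
    next
      case False
      then have "a2 = 0" using \<kappa>' by simp
      then have "l1 = 0" using L by auto
      then show ?thesis using \<open>A = \<kappa>1\<close> \<kappa>(3) by algebra
    qed
  qed
  moreover have "A = H \<longrightarrow> \<kappa>1 = H \<and> \<kappa>2 = H"
    using a \<kappa>' \<kappa>(3) by auto
  ultimately show ?thesis
    using l unfolding l1_def[symmetric] l2_def[symmetric] unfolding bc by algebra
qed

section \<open>Surfaces of constant mean curvature\<close>

locale parabolic_surface = pseudo_orthonormal +
  fixes U :: "(real \<times> real) set" and X N :: "real \<times> real \<Rightarrow> real^4"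
  assumes immersed: "immersed_surface U X"
    and unit_normal: "unit_normal_field U X N"
    and future: "\<And>u. u \<in> U \<Longrightarrow> mink (X u) \<vv> < 0"
    and invariant: "\<And>\<eta> u. u \<in> U \<Longrightarrow> parabolic \<eta> (X u) \<in> X ` U"
begin

abbreviation dX :: "real \<times> real \<Rightarrow> real \<times> real \<Rightarrow> real^4" where "dX u \<equiv> frechet_derivative X (at u)"
abbreviation dN :: "real \<times> real \<Rightarrow> real \<times> real \<Rightarrow> real^4" where "dN u \<equiv> frechet_derivative N (at u)"

lemma domain: "open U" "connected U" "U \<noteq> {}"
  using immersed by (auto simp: immersed_surface_def)

lemma has_derivative_X: "u \<in> U \<Longrightarrow> (X has_derivative dX u) (at u)"
  and has_derivative_N: "u \<in> U \<Longrightarrow> (N has_derivative dN u) (at u)"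
proof -
  have "Ck_on (Suc 0) U X" "Ck_on (Suc 0) U N"
    using immersed unit_normal unfolding immersed_surface_def unit_normal_field_def smooth_on_def by blast+
  then show "u \<in> U \<Longrightarrow> (X has_derivative dX u) (at u)" "u \<in> U \<Longrightarrow> (N has_derivative dN u) (at u)"
    by (auto simp: frechet_derivative_works)
qed

lemma X_hyperbolic: "u \<in> U \<Longrightarrow> mink (X u) (X u) = -1"
  using immersed by (auto simp: immersed_surface_def hyperbolic_space_def)

lemma mink_X_v: "u \<in> U \<Longrightarrow> mink (X u) \<vv> \<noteq> 0"
  by (rule less_imp_neq[OF future])

lemma linear_dX: "u \<in> U \<Longrightarrow> linear (dX u)" and linear_dN: "u \<in> U \<Longrightarrow> linear (dN u)"
  using has_derivative_X has_derivative_N has_derivative_linear by blast+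

lemma mink_X_dX: "mink (X u) (dX u w) = 0" if "u \<in> U"
proof -
  have "((\<lambda>u. mink (X u) (X u)) has_derivative (\<lambda>w. mink (X u) (dX u w) + mink (dX u w) (X u))) (at u)"
    by (rule mink.FDERIV[OF has_derivative_X has_derivative_X]) (rule that)+
  moreover have "((\<lambda>u. mink (X u) (X u)) has_derivative (\<lambda>w. 0)) (at u)"
    by (rule has_derivative_transform_within_open[OF has_derivative_const domain(1) that])
      (simp add: X_hyperbolic)
  ultimately have "(\<lambda>w. mink (X u) (dX u w) + mink (dX u w) (X u)) = (\<lambda>w. 0)"
    by (rule has_derivative_unique)
  from fun_cong[OF this, of w] show ?thesis by (simp add: mink_commute)
qed

lemma dX_eq_zero: "u \<in> U \<Longrightarrow> dX u w = 0 \<Longrightarrow> w = 0"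
  using immersed linear_dX[of u] by (metis immersed_surface_def injD linear_0)

lemma mink_N: "mink (N u) (N u) = 1" "mink (X u) (N u) = 0" "mink (N u) (dX u w) = 0" if "u \<in> U"
  using unit_normal that unfolding unit_normal_field_def by (auto simp: mink_commute simp del: split_paired_All)

text \<open>
  The rotation orbits are tangent to the surface: otherwise \<open>(z, \<psi>)\<close> is a local diffeomorphism
  somewhere, and by invariance the image of the surface has interior points in the \<open>(z, \<psi>, \<theta>)\<close> space.
\<close>

lemma exists_orbit_direction:
  assumes u: "u \<in> U"
  obtains w where "w \<noteq> 0" "frame_z (X u) (dX u w) = 0" "frame_\<psi> (X u) (dX u w) = 0"
proof (rule ccontr)
  assume "\<not> thesis"
  with that have none: "w = 0" if "frame_z (X u) (dX u w) = 0" "frame_\<psi> (X u) (dX u w) = 0" for w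
    using that by blast
  let ?f = "\<lambda>u. (height (X u), coord_\<psi> (X u))"
  let ?f' = "\<lambda>u w. (height (X u) * frame_z (X u) (dX u w), height (X u) * frame_\<psi> (X u) (dX u w))"
  have f': "(?f has_derivative ?f' u) (at u)" if "u \<in> U" for u
    by (intro has_derivative_Pair has_derivative_coord has_derivative_X mink_X_v that)
  have h: "height (X u) \<noteq> 0" using mink_X_v[OF u] by (simp add: height_def)
  have lin: "linear (?f' u)" using f'[OF u] has_derivative_linear by blast
  have "inj (?f' u)"
    unfolding linear_injective_0[OF lin] using none h by (auto simp: prod_eq_iff)
  then have "surj (?f' u)" by (rule linear_injective_imp_surjective[OF lin]) simp
  then obtain g' where g': "linear g'" "?f' u \<circ> g' = id"
    using linear_surjective_right_inverse[OF lin] by blast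
  let ?V = "interior (?f ` U)"
  \<comment> \<open>Surjectivity of the derivative at the single point \<open>u\<close> already
    makes \<open>?f u\<close> an interior point of the image.\<close>
  have "?f u \<in> ?V"
  proof (rule sussmann_open_mapping[OF domain(1) _ u f'[OF u] _ g'(2) subset_refl])
    show "continuous_on U ?f"
      using f' domain(1) by (meson continuous_at_imp_continuous_on has_derivative_continuous)
    show "bounded_linear g'" using g'(1) by (simp add: linear_linear)
    show "u \<in> interior U" using domain(1) u by (simp add: interior_open)
  qed
  then have V: "?V \<times> (UNIV :: real set) \<noteq> {}" "open (?V \<times> (UNIV :: real set))"
    by (auto intro: open_Times)
  \<comment> \<open>A differentiable image of a planar domain in three-space is negligible, yet
    rotating by arbitrary angles sweeps out the open cylinder over \<open>?V\<close>.\<close>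
  let ?g = "\<lambda>u. (?f u, coord_\<theta> (X u))"
  have "?g differentiable_on U"
    using has_derivative_Pair[OF f' has_derivative_coord(2)[OF has_derivative_X mink_X_v]]
    by (meson differentiable_def differentiable_at_imp_differentiable_on)
  then have "negligible (?g ` U)"
    by (intro negligible_differentiable_image_lowdim) auto
  moreover have "?V \<times> UNIV \<subseteq> ?g ` U"
  proof
    fix q assume "q \<in> ?V \<times> (UNIV :: real set)"
    then obtain y \<theta> where q: "q = (y, \<theta>)" "y \<in> ?f ` U" using interior_subset by blast
    then obtain u' where u': "u' \<in> U" "y = ?f u'" by blast
    obtain u'' where u'': "u'' \<in> U" "parabolic (\<theta> - coord_\<theta> (X u')) (X u') = X u''"
      using invariant[OF u'(1)] by (metis imageE)
    have "?g u'' = q"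
      unfolding q u'(2) u''(2)[symmetric] coord_parabolic[OF mink_X_v[OF u'(1)]] by simp
    then show "q \<in> ?g ` U" using u''(1) by blast
  qed
  ultimately have "negligible (?V \<times> (UNIV :: real set))"
    by (rule negligible_subset)
  then show False using V open_not_negligible by blast
qed

text \<open>The orbit direction has only a \<theta> component, and the normal is orthogonal to
  it.\<close>

lemma frame_\<theta>_N: "frame_\<theta> (X u) (N u) = 0" if u: "u \<in> U"
proof -
  obtain w where w: "w \<noteq> 0" "frame_z (X u) (dX u w) = 0" "frame_\<psi> (X u) (dX u w) = 0"
    using exists_orbit_direction[OF u] .
  have "frame_\<theta> (X u) (dX u w) \<noteq> 0"
    using frame_eq_zero[OF mink_X_v mink_X_dX _ w(3,2)] dX_eq_zero w(1) u by blast
  moreover have "frame_\<theta> (X u) (N u) * frame_\<theta> (X u) (dX u w) = 0"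
    using mink_frame[OF X_hyperbolic mink_X_v mink_N(2) mink_X_dX, of u w] mink_N(3)[of u w] u w by simp
  ultimately show ?thesis by simp
qed

definition A :: "real \<times> real \<Rightarrow> real" where "A u = frame_z (X u) (N u)"
definition B :: "real \<times> real \<Rightarrow> real" where "B u = frame_\<psi> (X u) (N u)"

lemma A_B_unit: "u \<in> U \<Longrightarrow> (A u)\<^sup>2 + (B u)\<^sup>2 = 1"
  using mink_frame[OF X_hyperbolic mink_X_v mink_N(2) mink_N(2), of u] mink_N(1)[of u] frame_\<theta>_N[of u]
  by (simp add: A_def B_def power2_eq_square)

lemma A_B_normal: "u \<in> U \<Longrightarrow> B u * frame_\<psi> (X u) (dX u w) + A u * frame_z (X u) (dX u w) = 0"
  using mink_frame[OF X_hyperbolic mink_X_v mink_N(2) mink_X_dX, of u w] mink_N(3)[of u w] frame_\<theta>_N[of u]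
  by (simp add: A_def B_def)

text \<open>Obtained by differentiating \<open>frame_\<theta>_N\<close>. On a principal direction it
  says that the curvature is A unless the \<theta> component vanishes.\<close>

lemma frame_dN_\<theta>: "A u * frame_\<theta> (X u) (dX u w) + frame_\<theta> (X u) (dN u w) = 0" if u: "u \<in> U"
proof -
  have "((\<lambda>u. frame_\<theta> (X u) (N u)) has_derivative (\<lambda>w. 0)) (at u)"
    by (rule has_derivative_transform_within_open[OF has_derivative_const domain(1) u])
      (simp add: frame_\<theta>_N)
  from has_derivative_unique[OF this has_derivative_frame(2)[OF has_derivative_X mink_X_v has_derivative_N]]
  show ?thesis using u unfolding A_def by (metis (no_types, lifting))
qed

text \<open>
  Differentiating the frame components of \<open>N\<close> along a principal direction with curvature \<open>\<kappa>\<close>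
  multiplies those of \<open>dX\<close> by \<open>A - \<kappa>\<close>. As the \<open>\<theta>\<close>-component of \<open>N\<close> vanishes,
  one principal curvature is \<open>A\<close>, hence the other one is \<open>2H - A\<close>.
\<close>

lemma mean_curvature_equations:
  assumes u: "u \<in> U" and H: "has_mean_curvature X N u H"
  shows "A u * frame_z (X u) (dX u w) + frame_z (X u) (dN u w) = 2 * (A u - H) * frame_z (X u) (dX u w)"
    and "A u * frame_\<psi> (X u) (dX u w) + frame_\<psi> (X u) (dN u w) = 2 * (A u - H) * frame_\<psi> (X u) (dX u w)"
    and "A u = H \<Longrightarrow> dN u w = - H *\<^sub>R dX u w"
    and "\<exists>w. A u * frame_\<psi> (X u) (dX u w) - B u * frame_z (X u) (dX u w) \<noteq> 0"
proof -
  obtain \<kappa>1 \<kappa>2 w1 w2 where H: "H = (\<kappa>1 + \<kappa>2) / 2"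
    and on: "mink (dX u w1) (dX u w1) = 1" "mink (dX u w2) (dX u w2) = 1" "mink (dX u w1) (dX u w2) = 0"
    and N: "dN u w1 = - \<kappa>1 *\<^sub>R dX u w1" "dN u w2 = - \<kappa>2 *\<^sub>R dX u w2"
    using H unfolding has_mean_curvature_def principal_curvatures_def Let_def by blast
  note lX = linear_add[OF linear_dX[OF u]] linear_scale[OF linear_dX[OF u]]
  note lN = linear_add[OF linear_dN[OF u]] linear_scale[OF linear_dN[OF u]]
  note metric = mink_frame[OF X_hyperbolic[OF u] mink_X_v[OF u] mink_X_dX[OF u] mink_X_dX[OF u]]
  note E = principal_frame_algebra[OF A_B_unit[OF u] A_B_normal[OF u, of w1] A_B_normal[OF u, of w2]
      on[unfolded metric], of \<kappa>1 \<kappa>2 H]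
  have \<kappa>: "(A u - \<kappa>1) * frame_\<theta> (X u) (dX u w1) = 0" "(A u - \<kappa>2) * frame_\<theta> (X u) (dX u w2) = 0"
    using frame_dN_\<theta>[OF u, of w1] frame_dN_\<theta>[OF u, of w2] unfolding N frame_scaleR by (simp_all add: algebra_simps)
  have "\<kappa>1 + \<kappa>2 = 2 * H" using H by simp
  note E = E[OF \<kappa> this]
  \<comment> \<open>The images of \<open>w1\<close> and \<open>w2\<close> are orthonormal, so these
    two vectors form a basis of the parameter plane.\<close>
  have "\<exists>c1 c2. w = c1 *\<^sub>R w1 + c2 *\<^sub>R w2"
  proof -
    let ?f = "\<lambda>c::real\<times>real. fst c *\<^sub>R w1 + snd c *\<^sub>R w2"
    have lin: "linear ?f" by (rule linearI) (auto simp: algebra_simps)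
    have "inj ?f"
    proof (subst linear_injective_0[OF lin], intro allI impI)
      fix c assume "?f c = 0"
      then have "dX u (?f c) = 0" using linear_0[OF linear_dX[OF u]] by simp
      then have "mink (dX u (?f c)) (dX u w1) = 0" "mink (dX u (?f c)) (dX u w2) = 0" by (simp_all add: mink_algebra)
      then show "c = 0"
        using on by (simp add: lX mink_algebra mink_commute[of "dX u w2" "dX u w1"] prod_eq_iff)
    qed
    then have "surj ?f" using lin linear_injective_imp_surjective by blast
    then show ?thesis by blast
  qed
  then obtain c1 c2 where w: "w = c1 *\<^sub>R w1 + c2 *\<^sub>R w2" by blast
  have 1: "A u * frame_z (X u) (dX u w) + frame_z (X u) (dN u w)
      = c1 * ((A u - \<kappa>1) * frame_z (X u) (dX u w1)) + c2 * ((A u - \<kappa>2) * frame_z (X u) (dX u w2))"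
    unfolding w lX lN N frame_add frame_scaleR by (simp add: algebra_simps)
  have 2: "A u * frame_\<psi> (X u) (dX u w) + frame_\<psi> (X u) (dN u w)
      = c1 * ((A u - \<kappa>1) * frame_\<psi> (X u) (dX u w1)) + c2 * ((A u - \<kappa>2) * frame_\<psi> (X u) (dX u w2))"
    unfolding w lX lN N frame_add frame_scaleR by (simp add: algebra_simps)
  have e: "(A u - \<kappa>1) * frame_z (X u) (dX u w1) = 2 * (A u - H) * frame_z (X u) (dX u w1)"
    "(A u - \<kappa>2) * frame_z (X u) (dX u w2) = 2 * (A u - H) * frame_z (X u) (dX u w2)"
    "(A u - \<kappa>1) * frame_\<psi> (X u) (dX u w1) = 2 * (A u - H) * frame_\<psi> (X u) (dX u w1)"
    "(A u - \<kappa>2) * frame_\<psi> (X u) (dX u w2) = 2 * (A u - H) * frame_\<psi> (X u) (dX u w2)"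
    using E by blast+
  show "A u * frame_z (X u) (dX u w) + frame_z (X u) (dN u w) = 2 * (A u - H) * frame_z (X u) (dX u w)"
    unfolding 1 e unfolding w lX frame_add frame_scaleR by (simp add: algebra_simps)
  show "A u * frame_\<psi> (X u) (dX u w) + frame_\<psi> (X u) (dN u w) = 2 * (A u - H) * frame_\<psi> (X u) (dX u w)"
    unfolding 2 e unfolding w lX frame_add frame_scaleR by (simp add: algebra_simps)
  show "dN u w = - H *\<^sub>R dX u w" if "A u = H"
  proof -
    have "\<kappa>1 = H" "\<kappa>2 = H" using E that by blast+
    then show ?thesis unfolding w lX lN N by (simp add: algebra_simps)
  qed
  \<comment> \<open>Two orthonormal directions cannot both lie along the orbit. This later makes the
    arc length function a submersion.\<close>
  show "\<exists>w. A u * frame_\<psi> (X u) (dX u w) - B u * frame_z (X u) (dX u w) \<noteq> 0"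
    using E by blast
qed

end

section \<open>Integration of the constant mean curvature equations\<close>

locale parabolic_cmc_surface = parabolic_surface +
  fixes H :: real
  assumes mean_curvature: "\<And>u. u \<in> U \<Longrightarrow> has_mean_curvature X N u H"
begin

lemma height_pos: "u \<in> U \<Longrightarrow> height (X u) > 0"
  using future[of u] by (simp add: height_def)

lemma has_derivative_A:
  "u \<in> U \<Longrightarrow> (A has_derivative (\<lambda>w. 2 * (A u - H) * frame_z (X u) (dX u w))) (at u)"
  using has_derivative_frame(1)[OF has_derivative_X mink_X_v has_derivative_N, of u]
    mean_curvature_equations(1)[OF _ mean_curvature, of u]
  unfolding A_def[abs_def] by simp

lemma has_derivative_B:
  "u \<in> U \<Longrightarrow> (B has_derivative (\<lambda>w. 2 * (A u - H) * frame_\<psi> (X u) (dX u w))) (at u)"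
  using has_derivative_frame(3)[OF has_derivative_X mink_X_v has_derivative_N, of u]
    mean_curvature_equations(2)[OF _ mean_curvature, of u]
  unfolding A_def[abs_def] B_def[abs_def] by simp

text \<open>The quotient of A - H by the squared height has zero derivative on the connected set
  \<open>U\<close>; \<open>C\<close> is minus its value.\<close>

lemma first_integral: "\<exists>C. \<forall>u\<in>U. A u = H - C * (height (X u))\<^sup>2"
proof -
  let ?g = "\<lambda>u. (A u - H) / (height (X u))\<^sup>2"
  have g: "(?g has_derivative (\<lambda>w. 0)) (at u)" if u: "u \<in> U" for u
    by (rule has_derivative_eq_rhs[OF has_derivative_divide'[OF
        has_derivative_diff[OF has_derivative_A[OF u] has_derivative_const]
        has_derivative_power[OF has_derivative_coord(1)[OF has_derivative_X[OF u] mink_X_v[OF u]]]]])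
      (use height_pos[OF u] in \<open>auto simp: field_simps power2_eq_square\<close>)
  obtain u0 where u0: "u0 \<in> U" using domain by blast
  have "A u = H - (- ?g u0) * (height (X u))\<^sup>2" if "u \<in> U" for u
  proof -
    have "?g u = ?g u0"
      using has_derivative_zero_unique_connected[OF domain(1,2) g that u0] .
    then have "A u - H = ?g u0 * (height (X u))\<^sup>2"
      using height_pos[OF that] by (subst (asm) nonzero_divide_eq_eq) auto
    then show ?thesis by simp
  qed
  then show ?thesis by blast
qed

text \<open>The case of vanishing \<open>C\<close>: the shape operator is \<open>H\<close> times the
  identity, so every principal curvature is \<open>H\<close>.\<close>

lemma totally_umbilic_if_A_eq:
  assumes "\<And>u. u \<in> U \<Longrightarrow> A u = H"
  shows "totally_umbilic U X N"
  unfolding totally_umbilic_def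
proof (intro ballI allI impI)
  fix u \<kappa>1 \<kappa>2 assume u: "u \<in> U" and "principal_curvatures X N u \<kappa>1 \<kappa>2"
  then obtain w1 w2 where on: "mink (dX u w1) (dX u w1) = 1" "mink (dX u w2) (dX u w2) = 1"
    and N: "dN u w1 = - \<kappa>1 *\<^sub>R dX u w1" "dN u w2 = - \<kappa>2 *\<^sub>R dX u w2"
    unfolding principal_curvatures_def Let_def by blast
  have "dN u w = - H *\<^sub>R dX u w" for w
    using mean_curvature_equations(3)[OF u mean_curvature[OF u] assms[OF u]] .
  with N have "\<kappa>1 *\<^sub>R dX u w1 = H *\<^sub>R dX u w1" "\<kappa>2 *\<^sub>R dX u w2 = H *\<^sub>R dX u w2" by auto
  moreover have "dX u w1 \<noteq> 0" "dX u w2 \<noteq> 0" using on by (auto simp: mink_algebra)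
  ultimately show "\<kappa>1 = \<kappa>2" by simp
qed

text \<open>\<open>I\<close> is the range of the arc length function \<open>t\<close> on
  \<open>U\<close>: an interval because \<open>U\<close> is connected, and open because the
  differential of \<open>t\<close> never vanishes.\<close>

lemma parametrization:
  assumes H: "\<bar>H\<bar> < 1" and not_umbilic: "\<not> totally_umbilic U X N"
  obtains C I \<psi>\<^sub>0 where "C \<noteq> 0" "open I" "is_interval I" "I \<noteq> {}"
    "\<And>t. t \<in> I \<Longrightarrow> jacobi_cn (cmc_modulus H C) (cmc_Xi C * t) > 0"
    "(\<lambda>u. (height (X u), coord_\<psi> (X u))) ` U = (\<lambda>t. (1 / cmc_r H C t, cmc_psi H C t + \<psi>\<^sub>0)) ` I"
proof -
  obtain C where C: "\<And>u. u \<in> U \<Longrightarrow> A u = H - C * (height (X u))\<^sup>2"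
    using first_integral by blast
  have "C \<noteq> 0"
    using C totally_umbilic_if_A_eq not_umbilic by force
  let ?z = "\<lambda>u. height (X u)" and ?\<psi> = "\<lambda>u. coord_\<psi> (X u)"
  let ?dz = "\<lambda>u w. ?z u * frame_z (X u) (dX u w)" and ?d\<psi> = "\<lambda>u w. ?z u * frame_\<psi> (X u) (dX u w)"
  have "\<exists>t \<psi>\<^sub>0. \<forall>u\<in>U. (t has_derivative (\<lambda>w. sgn C * (A u * ?d\<psi> u w - B u * ?dz u w))) (at u) \<and>
    jacobi_cn (cmc_modulus H C) (cmc_Xi C * t u) > 0 \<and>
    1 / ?z u = cmc_r H C (t u) \<and> ?\<psi> u = cmc_psi H C (t u) + \<psi>\<^sub>0"
  proof (rule profile_curve[OF domain H \<open>C \<noteq> 0\<close>])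
    fix u assume u: "u \<in> U"
    show "(?z has_derivative ?dz u) (at u)" "(?\<psi> has_derivative ?d\<psi> u) (at u)"
      using has_derivative_coord[OF has_derivative_X[OF u] mink_X_v[OF u]] by auto
    have "- 2 * C * ?z u * (?z u * x) = 2 * (A u - H) * x" for x
      using C[OF u] by (simp add: power2_eq_square)
    then show "(A has_derivative (\<lambda>w. - 2 * C * ?z u * ?dz u w)) (at u)"
      "(B has_derivative (\<lambda>w. - 2 * C * ?z u * ?d\<psi> u w)) (at u)"
      using has_derivative_A[OF u] has_derivative_B[OF u] by simp_all
    show "B u * ?d\<psi> u w + A u * ?dz u w = 0" for w
      using A_B_normal[OF u, of w] by algebra
  qed (use height_pos C A_B_unit in auto)
  then obtain t \<psi>\<^sub>0 where t: "\<And>u. u \<in> U \<Longrightarrow> (t has_derivative (\<lambda>w. sgn C * (A u * ?d\<psi> u w - B u * ?dz u w))) (at u)"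
    and cn: "\<And>u. u \<in> U \<Longrightarrow> jacobi_cn (cmc_modulus H C) (cmc_Xi C * t u) > 0"
    and z\<psi>: "\<And>u. u \<in> U \<Longrightarrow> 1 / ?z u = cmc_r H C (t u)" "\<And>u. u \<in> U \<Longrightarrow> ?\<psi> u = cmc_psi H C (t u) + \<psi>\<^sub>0"
    by blast
  have cont: "continuous_on U t"
    using t domain(1) by (meson continuous_at_imp_continuous_on has_derivative_continuous)
  have "t u \<in> interior (t ` U)" if u: "u \<in> U" for u
  proof -
    let ?L = "\<lambda>w. sgn C * (A u * ?d\<psi> u w - B u * ?dz u w)"
    obtain w where "A u * frame_\<psi> (X u) (dX u w) - B u * frame_z (X u) (dX u w) \<noteq> 0"
      using mean_curvature_equations(4)[OF u mean_curvature[OF u]] by blast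
    moreover have "?L w = sgn C * ?z u * (A u * frame_\<psi> (X u) (dX u w) - B u * frame_z (X u) (dX u w))"
      by (simp add: algebra_simps)
    ultimately have w: "?L w \<noteq> 0"
      using \<open>C \<noteq> 0\<close> height_pos[OF u] by (simp add: sgn_zero_iff)
    have lin: "linear ?L" using t[OF u] has_derivative_linear by blast
    define l where "l = ?L w"
    show ?thesis
    proof (rule sussmann_open_mapping[OF domain(1) cont u t[OF u]])
      \<comment> \<open>A right inverse of the differential, obtained by rescaling a direction
        \<open>w\<close> on which it takes the nonzero value \<open>l\<close>.\<close>
      show "bounded_linear (\<lambda>c. (c / l) *\<^sub>R w)"
        by (intro linear_linear[THEN iffD2] linearI)
          (simp_all add: add_divide_distrib scaleR_add_left)
      show "?L \<circ> (\<lambda>c. (c / l) *\<^sub>R w) = id"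
      proof
        fix c
        have "?L ((c / l) *\<^sub>R w) = (c / l) *\<^sub>R l"
          unfolding l_def by (rule linear_scale[OF lin])
        then show "(?L \<circ> (\<lambda>c. (c / l) *\<^sub>R w)) c = id c"
          using w unfolding l_def[symmetric] by simp
      qed
    qed (use domain u in \<open>auto simp: interior_open\<close>)
  qed
  then have "open (t ` U)"
    by (metis image_subsetI interior_subset open_interior subset_antisym)
  moreover have "is_interval (t ` U)"
    using connected_continuous_image[OF cont domain(2)] by (simp add: is_interval_connected_1)
  moreover have "(\<lambda>u. (?z u, ?\<psi> u)) ` U = (\<lambda>t. (1 / cmc_r H C t, cmc_psi H C t + \<psi>\<^sub>0)) ` (t ` U)"
    unfolding image_image by (intro image_cong) (simp_all add: z\<psi> flip: z\<psi>(1))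
  moreover have "t ` U \<noteq> {}" using domain(3) by simp
  moreover have "jacobi_cn (cmc_modulus H C) (cmc_Xi C * s) > 0" if "s \<in> t ` U" for s
    using that cn by blast
  ultimately show thesis
    using that[of C "t ` U" \<psi>\<^sub>0] \<open>C \<noteq> 0\<close> by blast
qed

text \<open>The profile determines the surface: a point with the right height and \<psi> coordinate
  can be rotated within the surface to any prescribed \<theta>.\<close>

lemma image_eq:
  assumes "(\<lambda>u. (height (X u), coord_\<psi> (X u))) ` U = (\<lambda>t. (1 / r t, \<psi> t)) ` I"
  shows "X ` U = (\<lambda>(\<theta>, t). ((1 + (r t)\<^sup>2 * ((\<psi> t)\<^sup>2 + \<theta>\<^sup>2)) / (2 * r t)) *\<^sub>R \<vv> + (r t * \<theta>) *\<^sub>R \<ee>\<^sub>1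
    + r t *\<^sub>R \<oo> + (r t * \<psi> t) *\<^sub>R \<ee>\<^sub>2) ` (UNIV \<times> I)" (is "_ = ?F ` _")
proof (intro subset_antisym subsetI)
  fix x assume "x \<in> X ` U"
  then obtain u where u: "u \<in> U" "x = X u" by blast
  then have "(height (X u), coord_\<psi> (X u)) \<in> (\<lambda>t. (1 / r t, \<psi> t)) ` I"
    unfolding assms[symmetric] by blast
  then obtain t where t: "t \<in> I" "height (X u) = 1 / r t" "coord_\<psi> (X u) = \<psi> t"
    by blast
  have "x = ?F (coord_\<theta> x, t)"
    using coord_expansion[OF X_hyperbolic future, OF u(1,1), of "r t"] t u(2) by simp
  then show "x \<in> ?F ` (UNIV \<times> I)" using t(1) by blast
next
  fix x assume "x \<in> ?F ` (UNIV \<times> I)"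
  then obtain \<theta> t where t: "t \<in> I" "x = ?F (\<theta>, t)" by blast
  then have "(1 / r t, \<psi> t) \<in> (\<lambda>u. (height (X u), coord_\<psi> (X u))) ` U"
    unfolding assms by blast
  then obtain u where u: "u \<in> U" "height (X u) = 1 / r t" "coord_\<psi> (X u) = \<psi> t"
    by force
  obtain u' where u': "u' \<in> U" "parabolic (\<theta> - coord_\<theta> (X u)) (X u) = X u'"
    using invariant[OF u(1)] by (metis imageE)
  have "height (X u') = 1 / r t" "coord_\<psi> (X u') = \<psi> t" "coord_\<theta> (X u') = \<theta>"
    unfolding u'(2)[symmetric] coord_parabolic[OF mink_X_v[OF u(1)]] using u by simp_all
  then have "X u' = x"
    using coord_expansion[OF X_hyperbolic future, OF u'(1,1), of "r t"] t(2) by simp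
  then show "x \<in> X ` U" using u'(1) by blast
qed

end

section \<open>Choice of a basis absorbing the additive constant of \<psi>\<close>

theorem theorem4p15:
  fixes U :: "(real \<times> real) set" and X N :: "real \<times> real \<Rightarrow> real^4" and H :: real
  assumes "immersed_surface U X"
    and "parabolic_rotational (X ` U)"
    and "unit_normal_field U X N"
    and "\<forall>u\<in>U. has_mean_curvature X N u H"
    and "H \<ge> 0" and "H\<^sup>2 < 1"
    and "\<not> totally_umbilic U X N"
  shows "\<exists>\<vv> \<ee>\<^sub>1 \<oo> \<ee>\<^sub>2 C I.
    pseudo_orthonormal_basis \<vv> \<ee>\<^sub>1 \<oo> \<ee>\<^sub>2 \<and> C \<noteq> 0 \<and>
    open I \<and> is_interval I \<and> I \<noteq> {} \<and>
    (\<forall>t\<in>I. jacobi_cn (cmc_modulus H C) (cmc_Xi C * t) > 0) \<and>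
    X ` U = (\<lambda>(\<theta>, t). let r = cmc_r H C t; \<psi> = cmc_psi H C t in
        ((1 + r\<^sup>2 * (\<psi>\<^sup>2 + \<theta>\<^sup>2)) / (2 * r)) *\<^sub>R \<vv> + (r * \<theta>) *\<^sub>R \<ee>\<^sub>1 + r *\<^sub>R \<oo> + (r * \<psi>) *\<^sub>R \<ee>\<^sub>2)
      ` (UNIV \<times> I)"
proof -
  have sub: "X ` U \<subseteq> hyperbolic_space" using assms(1) by (simp add: immersed_surface_def)
  have H: "\<bar>H\<bar> < 1" using assms(6) by (simp add: abs_square_less_1)
  obtain \<vv> \<ee>\<^sub>1 \<oo> \<ee>\<^sub>2 where basis: "pseudo_orthonormal \<vv> \<ee>\<^sub>1 \<oo> \<ee>\<^sub>2" "\<And>x. x \<in> X ` U \<Longrightarrow> mink x \<vv> < 0"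
    "\<And>\<theta> x. x \<in> X ` U \<Longrightarrow> pseudo_orthonormal.parabolic \<vv> \<ee>\<^sub>1 \<theta> x \<in> X ` U"
    using parabolic_rotational_basis[OF assms(2) sub] by blast
  note orbits = basis(2)[OF imageI] basis(3)[OF imageI]
  interpret pseudo_orthonormal \<vv> \<ee>\<^sub>1 \<oo> \<ee>\<^sub>2 by (rule basis(1))
  interpret parabolic_cmc_surface \<vv> \<ee>\<^sub>1 \<oo> \<ee>\<^sub>2 U X N H
    by unfold_locales (use assms(1,3,4) in \<open>blast intro: orbits\<close>)+
  obtain C I \<psi>\<^sub>0 where C: "C \<noteq> 0" "open I" "is_interval I" "I \<noteq> {}"
    "\<And>t. t \<in> I \<Longrightarrow> jacobi_cn (cmc_modulus H C) (cmc_Xi C * t) > 0"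
    and img: "(\<lambda>u. (height (X u), coord_\<psi> (X u))) ` U = (\<lambda>t. (1 / cmc_r H C t, cmc_psi H C t + \<psi>\<^sub>0)) ` I"
    using parametrization[OF H assms(7)] by blast
  let ?e = "\<ee>\<^sub>2 + \<psi>\<^sub>0 *\<^sub>R \<vv>" and ?o = "\<oo> + \<psi>\<^sub>0 *\<^sub>R \<ee>\<^sub>2 + (\<psi>\<^sub>0\<^sup>2 / 2) *\<^sub>R \<vv>"
  interpret s: pseudo_orthonormal \<vv> \<ee>\<^sub>1 ?o ?e
    by unfold_locales (rule shifted_basis)
  \<comment> \<open>The shift keeps \<open>\<vv>\<close> and \<open>\<ee>\<^sub>1\<close>, hence
    also the rotation group and the sign condition, so the same surface fits the new basis.\<close>
  interpret s: parabolic_cmc_surface \<vv> \<ee>\<^sub>1 ?o ?e U X N H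
    by unfold_locales (use assms(1,3,4) in \<open>blast intro: orbits\<close>)+
  have "s.coord_\<psi> (X u) = coord_\<psi> (X u) - \<psi>\<^sub>0" if "u \<in> U" for u
    using mink_X_v[OF that] by (simp add: s.coord_\<psi>_def coord_\<psi>_def mink_algebra field_simps)
  then have "(\<lambda>u. (s.height (X u), s.coord_\<psi> (X u))) ` U
      = (\<lambda>(a, b). (a, b - \<psi>\<^sub>0)) ` (\<lambda>u. (height (X u), coord_\<psi> (X u))) ` U"
    unfolding image_image by (intro image_cong) (simp_all add: height_def s.height_def)
  also have "\<dots> = (\<lambda>t. (1 / cmc_r H C t, cmc_psi H C t)) ` I"
    unfolding img image_image by simp
  finally have "X ` U = (\<lambda>(\<theta>, t). let r = cmc_r H C t; \<psi> = cmc_psi H C t in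
        ((1 + r\<^sup>2 * (\<psi>\<^sup>2 + \<theta>\<^sup>2)) / (2 * r)) *\<^sub>R \<vv> + (r * \<theta>) *\<^sub>R \<ee>\<^sub>1 + r *\<^sub>R ?o + (r * \<psi>) *\<^sub>R ?e)
      ` (UNIV \<times> I)"
    unfolding Let_def by (rule s.image_eq)
  with C s.basis show ?thesis by blast
qed

end
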